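(* Let $(P,\circ_\lambda,\succ_\lambda)$ be a pre-Poisson conformal algebra in which $P$ is free as a $\mathbf k[\partial]$-module and let $(P,[\cdot_\lambda\cdot],\cdot_\lambda\cdot)$ be its associated Poisson conformal algebra, i.e. $[a_\lambda b]=a\circ_\lambda b-b\circ_{-\lambda-\partial}a$ and $a_\lambda b=a\succ_\lambda b+b\succ_{-\lambda-\partial}a$ for $a,b\in P$. Then $$r=\sum_{i=1}^n(e_i\otimes e_i^\ast-e_i^\ast\otimes e_i)$$ is a solution of the Poisson conformal Yang-Baxter equation (PCYBE) in $P\ltimes_{\mathfrak L_\circ^\ast,-\mathfrak L_\succ^\ast}P^{\ast c}$, where $\{e_1,\ldots,e_n\}$ is a $\mathbf k[\partial]$-basis of $P$ and $\{e_1^\ast,\ldots,e_n^\ast\}$ is the dual $\mathbf k[\partial]$-basis of $P^{\ast c}$.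
   Context: Let $\mathbf k$ be a field of characteristic $0$. All $\mathbf k[\partial]$-modules are assumed finitely generated; $\otimes$ is over $\mathbf k$, $I$ is the identity. A left-symmetric conformal algebra $(P,\circ_\lambda)$ is a $\mathbf k[\partial]$-module $P$ with a $\mathbf k$-bilinear map $\circ_\lambda:P\times P\to P[\lambda]$ such that $(\partial a)\circ_\lambda b=-\lambda a\circ_\lambda b$, $a\circ_\lambda(\partial b)=(\partial+\lambda)a\circ_\lambda b$ and $a\circ_\lambda(b\circ_\mu c)-(a\circ_\lambda b)\circ_{\lambda+\mu}c=b\circ_\mu(a\circ_\lambda c)-(b\circ_\mu a)\circ_{\lambda+\mu}c$. A Zinbiel conformal algebra $(P,\succ_\lambda)$ is a $\mathbf k[\partial]$-module $P$ with a $\mathbf k$-bilinear map $\succ_\lambda:P\times P\to P[\lambda]$ such that $(\partial a)\succ_\lambda b=-\lambda a\succ_\lambda b$, $a\succ_\lambda(\partial b)=(\partial+\lambda)a\succ_\lambda b$ and $a\succ_\lambda(b\succ_\mu c)=(a\succ_\lambda b+b\succ_{-\lambda-\partial}a)\succ_{\lambda+\mu}c$. A pre-Poisson conformal algebra is a triple $(P,\circ_\lambda,\succ_\lambda)$ where $(P,\succ_\lambda)$ is a Zinbiel conformal algebra, $(P,\circ_\lambda)$ is a left-symmetric conformal algebra and $(a\circ_\lambda b-b\circ_{-\lambda-\partial}a)\succ_{\lambda+\mu}c=a\circ_\lambda(b\succ_\mu c)-b\succ_\mu(a\circ_\lambda c)$, $(a\succ_\lambda b+b\succ_{-\lambda-\partial}a)\circ_{\lambda+\mu}c=a\succ_\lambda(b\circ_\mu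 c)+b\succ_\mu(a\circ_\lambda c)$. (Substitution convention: if $b\circ_\nu a=\sum_k\nu^kc_k$ then $b\circ_{-\lambda-\partial}a=\sum_k(-\lambda-\partial)^kc_k$; similarly for other products and maps.) A Poisson conformal algebra $(P,[\cdot_\lambda\cdot],\cdot_\lambda\cdot)$ is a $\mathbf k[\partial]$-module with $\mathbf k$-bilinear maps $[\cdot_\lambda\cdot],\cdot_\lambda\cdot:P\times P\to P[\lambda]$ such that $[(\partial a)_\lambda b]=-\lambda[a_\lambda b]$, $[a_\lambda(\partial b)]=(\partial+\lambda)[a_\lambda b]$, $[a_\lambda b]=-[b_{-\lambda-\partial}a]$, $[a_\lambda[b_\mu c]]=[[a_\lambda b]_{\lambda+\mu}c]+[b_\mu[a_\lambda c]]$; $(\partial a)_\lambda b=-\lambda a_\lambda b$, $a_\lambda(\partial b)=(\partial+\lambda)a_\lambda b$, $(a_\lambda b)_{\lambda+\mu}c=a_\lambda(b_\mu c)$, $a_\lambda b=b_{-\lambda-\partial}a$; and $[a_\lambda(b_\mu c)]=[a_\lambda b]_{\lambda+\mu}c+b_\mu[a_\lambda c]$. A conformal linear map $f:U\to V$ is a $\mathbf k$-linear map $f_\lambda:U\to V[\lambda]$ with $f_\lambda(\partial u)=(\partial+\lambda)f_\lambda u$; they form a $\mathbf k[\partial]$-module $\mathrm{Chom}(U,V)$ with $(\partial f)_\lambda=-\lambda f_\lambda$; $\mathrm{gc}(V)=\mathrm{Chom}(V,V)$ and $U^{\ast c}=\mathrm{Chom}(U,\mathbf k)$ with $\mathbf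 k$ the trivial module. The dual basis is determined by $(e_i^\ast)_\lambda(e_j)=\delta_{ij}$. For $\varphi:P\to\mathrm{gc}(V)$, $\varphi^\ast:P\to\mathrm{gc}(V^{\ast c})$ is $(\varphi^\ast(a)_\lambda f)_\mu u=-f_{\mu-\lambda}(\varphi(a)_\lambda u)$. Put $\mathfrak L_\circ(a)_\lambda b=a\circ_\lambda b$, $\mathfrak L_\succ(a)_\lambda b=a\succ_\lambda b$. The semi-direct product $P\ltimes_{\mathfrak L_\circ^\ast,-\mathfrak L_\succ^\ast}P^{\ast c}$ is the Poisson conformal algebra on $P\oplus P^{\ast c}$ with, for $a,b\in P$, $f,g\in P^{\ast c}$, $[(a+f)_\lambda(b+g)]=[a_\lambda b]+\mathfrak L_\circ^\ast(a)_\lambda g-\mathfrak L_\circ^\ast(b)_{-\lambda-\partial}f$ and $(a+f)_\lambda(b+g)=a_\lambda b-\mathfrak L_\succ^\ast(a)_\lambda g-\mathfrak L_\succ^\ast(b)_{-\lambda-\partial}f$. For a Poisson conformal algebra $Q$, put $\partial^{\otimes^2}=\partial\otimes I+I\otimes\partial$, $\partial^{\otimes^3}=\partial\otimes I\otimes I+I\otimes\partial\otimes I+I\otimes I\otimes\partial$, and for $r=\sum_ir_i\otimes l_i\in Q\otimes Q$: $[[r,r]]=\sum_{i,j}\big([{r_i}_\mu r_j]\otimes l_i\otimes l_j|_{\mu=I\otimes\partial\otimes I}-r_i\otimes[{r_j}_\mu l_i]\otimes l_j|_{\mu=I\otimes I\otimes\partial}-r_i\otimes r_j\otimes[{l_j}_\mu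 l_i]|_{\mu=I\otimes\partial\otimes I}\big)$, $r\bullet r=\sum_{i,j}\big(r_i\otimes r_j\otimes{l_i}_\mu l_j|_{\mu=\partial\otimes I\otimes I}-r_i\otimes{r_j}_\mu l_i\otimes l_j|_{\mu=-\partial^{\otimes^2}\otimes I}+{r_i}_\mu r_j\otimes l_i\otimes l_j|_{\mu=I\otimes\partial\otimes I}\big)$, where a substitution means that the polynomial in $\mu$ acts on the tensor coefficients through the given operator. $r$ is a solution of the PCYBE in $Q$ if both $[[r,r]]$ and $r\bullet r$ lie in $\partial^{\otimes^3}(Q\otimes Q\otimes Q)$. *)

theory Defs
  imports
    "HOL-Computational_Algebra.Polynomial"
    "HOL-Library.Poly_Mapping"
    "HOL-Library.Function_Algebras"
    "HOL-Library.Product_Plus"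
begin

text \<open>
  The ring \<open>k[\<partial>]\<close> is the polynomial ring \<open>'k poly\<close>, so a \<open>k[\<partial>]\<close>-module is an instance \<open>s\<close> of the
  library locale \<open>module\<close> over \<open>'k poly\<close>.  The derivation is multiplication by the variable, and
  scalars of \<open>k\<close> act as constant polynomials.  For a module with elements of type \<open>'v\<close>, the space
  \<open>V[\<lambda>]\<close> is \<open>'v poly\<close>, on which \<open>\<lambda>\<close> acts as \<open>pCons 0\<close> and \<open>\<partial>\<close> acts coefficientwise.
\<close>

definition pd :: "('k::comm_ring_1 poly \<Rightarrow> 'v \<Rightarrow> 'v) \<Rightarrow> 'v \<Rightarrow> 'v" where
  "pd s v = s [:0, 1:] v"

definition kscale :: "('k::comm_ring_1 poly \<Rightarrow> 'v \<Rightarrow> 'v) \<Rightarrow> 'k \<Rightarrow> 'v \<Rightarrow> 'v" where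
  "kscale s c v = s [:c:] v"

locale kd_module = module s
  for s :: "'k::field_char_0 poly \<Rightarrow> 'v::ab_group_add \<Rightarrow> 'v" +
  assumes finitely_generated: "\<exists>S. finite S \<and> module.span s S = UNIV"

definition kd_basis :: "('k::comm_ring_1 poly \<Rightarrow> 'v::ab_group_add \<Rightarrow> 'v) \<Rightarrow> nat \<Rightarrow> (nat \<Rightarrow> 'v) \<Rightarrow> bool" where
  "kd_basis s n e \<longleftrightarrow>
     inj_on e {1..n} \<and> \<not> module.dependent s (e ` {1..n}) \<and> module.span s (e ` {1..n}) = UNIV"


section \<open>Substitution for the indeterminate\<close>

text \<open>
  For \<open>p = \<Sum>k. \<nu>^k p_k\<close> the value of \<open>psubst T h p\<close> is \<open>\<Sum>k. T^k (h p_k)\<close>: the operator \<open>T\<close> is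
  substituted for \<open>\<nu>\<close>, and \<open>h\<close> maps the coefficients to the space on which \<open>T\<close> acts.
\<close>

definition psubst :: "('w::comm_monoid_add \<Rightarrow> 'w) \<Rightarrow> ('v::zero \<Rightarrow> 'w) \<Rightarrow> 'v poly \<Rightarrow> 'w" where
  "psubst T h p = (\<Sum>k\<le>degree p. (T ^^ k) (h (coeff p k)))"

text \<open>For \<open>q = b \<circ>_\<nu> a\<close> the polynomial \<open>skew s q\<close> is \<open>b \<circ>_{-\<lambda>-\<partial>} a\<close>.\<close>

definition skew :: "('k::comm_ring_1 poly \<Rightarrow> 'v::ab_group_add \<Rightarrow> 'v) \<Rightarrow> 'v poly \<Rightarrow> 'v poly" where
  "skew s q = psubst (\<lambda>F. - pCons 0 F - map_poly (pd s) F) (\<lambda>v. [:v:]) q"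

text \<open>\<open>V[\<lambda>,\<mu>]\<close> is \<open>'v poly poly\<close> with inner variable \<open>\<lambda>\<close> and outer variable \<open>\<mu>\<close>.\<close>

definition lam :: "'v::zero poly poly \<Rightarrow> 'v poly poly" where
  "lam F = map_poly (pCons 0) F"

definition mu :: "'v::zero poly poly \<Rightarrow> 'v poly poly" where
  "mu F = pCons 0 F"

text \<open>
  With \<open>S\<close>, \<open>T\<close> the two variables in either order, \<open>nested S T m m' a b c\<close> is \<open>a m_S (b m'_T c)\<close>,
  and, for \<open>q\<close> a polynomial in \<open>S\<close>, \<open>composed S T q m c\<close> is \<open>q m_{S+T} c\<close>.
\<close>

definition nested ::
  "('v::ab_group_add poly poly \<Rightarrow> 'v poly poly) \<Rightarrow> ('v poly poly \<Rightarrow> 'v poly poly) \<Rightarrow>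
   ('v \<Rightarrow> 'v \<Rightarrow> 'v poly) \<Rightarrow> ('v \<Rightarrow> 'v \<Rightarrow> 'v poly) \<Rightarrow> 'v \<Rightarrow> 'v \<Rightarrow> 'v \<Rightarrow> 'v poly poly" where
  "nested S T m m' a b c = psubst T (\<lambda>x. psubst S (\<lambda>y. [:[:y:]:]) (m a x)) (m' b c)"

definition composed ::
  "('v::ab_group_add poly poly \<Rightarrow> 'v poly poly) \<Rightarrow> ('v poly poly \<Rightarrow> 'v poly poly) \<Rightarrow>
   'v poly \<Rightarrow> ('v \<Rightarrow> 'v \<Rightarrow> 'v poly) \<Rightarrow> 'v \<Rightarrow> 'v poly poly" where
  "composed S T q m c = psubst S (\<lambda>x. psubst (\<lambda>F. S F + T F) (\<lambda>y. [:[:y:]:]) (m x c)) q"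


section \<open>Pre-Poisson conformal algebras\<close>

locale conformal_product = kd_module s
  for s :: "'k::field_char_0 poly \<Rightarrow> 'v::ab_group_add \<Rightarrow> 'v" +
  fixes m :: "'v \<Rightarrow> 'v \<Rightarrow> 'v poly"
  assumes add_left: "m (a + a') b = m a b + m a' b"
    and add_right: "m a (b + b') = m a b + m a b'"
    and scale_left: "m (kscale s x a) b = map_poly (kscale s x) (m a b)"
    and scale_right: "m a (kscale s x b) = map_poly (kscale s x) (m a b)"
    and sesqui_left: "m (pd s a) b = - pCons 0 (m a b)"
    and sesqui_right: "m a (pd s b) = map_poly (pd s) (m a b) + pCons 0 (m a b)"

locale left_symmetric_conformal_algebra = conformal_product s circ
  for s :: "'k::field_char_0 poly \<Rightarrow> 'v::ab_group_add \<Rightarrow> 'v" and circ +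
  assumes left_symmetric:
    "nested lam mu circ circ a b c - composed lam mu (circ a b) circ c =
     nested mu lam circ circ b a c - composed mu lam (circ b a) circ c"

locale zinbiel_conformal_algebra = conformal_product s zin
  for s :: "'k::field_char_0 poly \<Rightarrow> 'v::ab_group_add \<Rightarrow> 'v" and zin +
  assumes zinbiel:
    "nested lam mu zin zin a b c = composed lam mu (zin a b + skew s (zin b a)) zin c"

locale pre_poisson_conformal_algebra =
  left_symmetric_conformal_algebra s circ + Z: zinbiel_conformal_algebra s zin
  for s :: "'k::field_char_0 poly \<Rightarrow> 'v::ab_group_add \<Rightarrow> 'v" and circ and zin +
  assumes compat_zin:
    "composed lam mu (circ a b - skew s (circ b a)) zin c =
     nested lam mu circ zin a b c - nested mu lam zin circ b a c"
  and compat_circ: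
    "composed lam mu (zin a b + skew s (zin b a)) circ c =
     nested lam mu zin circ a b c + nested mu lam zin circ b a c"

definition assoc_bracket ::
  "('k::comm_ring_1 poly \<Rightarrow> 'v::ab_group_add \<Rightarrow> 'v) \<Rightarrow> ('v \<Rightarrow> 'v \<Rightarrow> 'v poly) \<Rightarrow> 'v \<Rightarrow> 'v \<Rightarrow> 'v poly" where
  "assoc_bracket s circ a b = circ a b - skew s (circ b a)"

definition assoc_product ::
  "('k::comm_ring_1 poly \<Rightarrow> 'v::ab_group_add \<Rightarrow> 'v) \<Rightarrow> ('v \<Rightarrow> 'v \<Rightarrow> 'v poly) \<Rightarrow> 'v \<Rightarrow> 'v \<Rightarrow> 'v poly" where
  "assoc_product s zin a b = zin a b + skew s (zin b a)"


section \<open>Conformal linear maps and conformal duals\<close>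

definition Chom ::
  "('k::comm_ring_1 poly \<Rightarrow> 'u::ab_group_add \<Rightarrow> 'u) \<Rightarrow> ('k poly \<Rightarrow> 'v::ab_group_add \<Rightarrow> 'v) \<Rightarrow>
   ('u \<Rightarrow> 'v poly) set" where
  "Chom s t = {f.
     (\<forall>u u'. f (u + u') = f u + f u') \<and>
     (\<forall>c u. f (kscale s c u) = map_poly (kscale t c) (f u)) \<and>
     (\<forall>u. f (pd s u) = map_poly (pd t) (f u) + pCons 0 (f u))}"

text \<open>
  The module structure \<open>(\<partial>f)_\<lambda> = -\<lambda> f_\<lambda>\<close>.  It is given on all functions \<open>'u \<Rightarrow> 'v poly\<close>;
  \<open>Chom s t\<close> is the submodule of interest.
\<close>

definition Chom_scale ::
  "('k::comm_ring_1 poly \<Rightarrow> 'v::ab_group_add \<Rightarrow> 'v) \<Rightarrow> 'k poly \<Rightarrow> ('u \<Rightarrow> 'v poly) \<Rightarrow> 'u \<Rightarrow> 'v poly" where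
  "Chom_scale t p f = (\<lambda>u. psubst (\<lambda>F. - pCons 0 F) (\<lambda>c. map_poly (kscale t c) (f u)) p)"

text \<open>The trivial module \<open>k\<close>, on which \<open>\<partial>\<close> acts as \<open>0\<close>.\<close>

definition triv_scale :: "'k::comm_ring_1 poly \<Rightarrow> 'k \<Rightarrow> 'k" where
  "triv_scale p x = poly p 0 * x"

definition cdual ::
  "('k::comm_ring_1 poly \<Rightarrow> 'u::ab_group_add \<Rightarrow> 'u) \<Rightarrow> ('u \<Rightarrow> 'k poly) set" where
  "cdual s = Chom s triv_scale"

definition dual_basis ::
  "('k::comm_ring_1 poly \<Rightarrow> 'v::ab_group_add \<Rightarrow> 'v) \<Rightarrow> nat \<Rightarrow> (nat \<Rightarrow> 'v) \<Rightarrow> (nat \<Rightarrow> 'v \<Rightarrow> 'k poly) \<Rightarrow> bool" where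
  "dual_basis s n e e' \<longleftrightarrow>
     (\<forall>i\<in>{1..n}. e' i \<in> cdual s \<and> (\<forall>j\<in>{1..n}. e' i (e j) = (if i = j then 1 else 0)))"

text \<open>
  \<open>dual_rep \<phi> a f\<close> is \<open>\<phi>\<^sup>*(a)_\<lambda> f\<close>, a polynomial in \<open>\<lambda>\<close> with coefficients in the conformal dual.  For fixed
  \<open>u\<close>, \<open>dual_rep_at \<phi> a f u\<close> is \<open>-f_{\<mu>-\<lambda>}(\<phi>(a)_\<lambda> u)\<close>, an element of \<open>k[\<lambda>,\<mu>]\<close>, and its coefficient
  of \<open>\<lambda>^n\<close>, a polynomial in \<open>\<mu>\<close>, is the value at \<open>u\<close> of the coefficient of \<open>\<lambda>^n\<close> in \<open>\<phi>\<^sup>*(a)_\<lambda> f\<close>.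
  For \<open>f\<close> conformal linear on a finitely generated module and \<open>\<phi>(a)\<close> conformal linear, the degree in
  \<open>\<lambda>\<close> is bounded uniformly in \<open>u\<close>, so that \<open>Abs_poly\<close> is applied to a sequence of finite support.
\<close>

definition dual_rep_at ::
  "('p \<Rightarrow> 'v \<Rightarrow> 'v::ab_group_add poly) \<Rightarrow> 'p \<Rightarrow> ('v \<Rightarrow> 'k::comm_ring_1 poly) \<Rightarrow> 'v \<Rightarrow> 'k poly poly" where
  "dual_rep_at \<phi> a f u =
     - psubst lam (\<lambda>x. psubst (\<lambda>F. mu F - lam F) (\<lambda>c. [:[:c:]:]) (f x)) (\<phi> a u)"

definition dual_rep ::
  "('p \<Rightarrow> 'v \<Rightarrow> 'v::ab_group_add poly) \<Rightarrow> 'p \<Rightarrow> ('v \<Rightarrow> 'k::comm_ring_1 poly) \<Rightarrow> ('v \<Rightarrow> 'k poly) poly" where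
  "dual_rep \<phi> a f = Abs_poly (\<lambda>n u. map_poly (\<lambda>q. coeff q n) (dual_rep_at \<phi> a f u))"


section \<open>Semi-direct products\<close>

text \<open>
  The products of \<open>P \<ltimes>_{\<rho>,\<sigma>} V\<close>, for \<open>\<rho>, \<sigma>: P \<rightarrow> gc(V)\<close>, on pairs \<open>(a, v)\<close> standing for \<open>a + v\<close>;
  \<open>t\<close> is the module structure of \<open>V\<close>.
\<close>

definition sd_scale ::
  "('k poly \<Rightarrow> 'p \<Rightarrow> 'p) \<Rightarrow> ('k::comm_ring_1 poly \<Rightarrow> 'v \<Rightarrow> 'v) \<Rightarrow> 'k poly \<Rightarrow> 'p \<times> 'v \<Rightarrow> 'p \<times> 'v" where
  "sd_scale s t p x = (s p (fst x), t p (snd x))"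

definition sd_bracket ::
  "('k::comm_ring_1 poly \<Rightarrow> 'v \<Rightarrow> 'v) \<Rightarrow> ('p \<Rightarrow> 'p \<Rightarrow> 'p poly) \<Rightarrow> ('p \<Rightarrow> 'v \<Rightarrow> 'v poly) \<Rightarrow>
   'p::ab_group_add \<times> 'v::ab_group_add \<Rightarrow> 'p \<times> 'v \<Rightarrow> ('p \<times> 'v) poly" where
  "sd_bracket t br \<rho> x y =
     map_poly (\<lambda>a. (a, 0)) (br (fst x) (fst y)) +
     map_poly (\<lambda>v. (0, v)) (\<rho> (fst x) (snd y) - skew t (\<rho> (fst y) (snd x)))"

definition sd_product ::
  "('k::comm_ring_1 poly \<Rightarrow> 'v \<Rightarrow> 'v) \<Rightarrow> ('p \<Rightarrow> 'p \<Rightarrow> 'p poly) \<Rightarrow> ('p \<Rightarrow> 'v \<Rightarrow> 'v poly) \<Rightarrow>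
   'p::ab_group_add \<times> 'v::ab_group_add \<Rightarrow> 'p \<times> 'v \<Rightarrow> ('p \<times> 'v) poly" where
  "sd_product t pr \<sigma> x y =
     map_poly (\<lambda>a. (a, 0)) (pr (fst x) (fst y)) +
     map_poly (\<lambda>v. (0, v)) (\<sigma> (fst x) (snd y) + skew t (\<sigma> (fst y) (snd x)))"


section \<open>Tensors\<close>

text \<open>
  For a submodule \<open>Q\<close> of \<open>'q\<close>, the space \<open>Q \<otimes> Q \<otimes> Q\<close> over \<open>k\<close> is the quotient of the free vector space
  on \<open>Q \<times> Q \<times> Q\<close>, the elements of \<open>('q \<times> 'q \<times> 'q) \<Rightarrow>\<^sub>0 'k\<close> with keys in \<open>Q \<times> Q \<times> Q\<close>, by the subspace
  \<open>tensor3_rel s Q\<close> spanned by the multilinearity relations.  Tensors are given by representatives, and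
  equality of tensors is congruence modulo \<open>tensor3_rel s Q\<close>.  Likewise an element \<open>\<Sum>i. r_i \<otimes> l_i\<close> of
  \<open>Q \<otimes> Q\<close> is given by a formal combination of pairs.  A pure tensor with a zero entry is a nonzero
  formal combination, but lies in \<open>tensor3_rel s Q\<close>.
\<close>

definition fscale :: "'k::field \<Rightarrow> ('a \<Rightarrow>\<^sub>0 'k) \<Rightarrow> 'a \<Rightarrow>\<^sub>0 'k" where
  "fscale c x = Poly_Mapping.map ((*) c) x"

lemma lookup_fscale [simp]: "Poly_Mapping.lookup (fscale c x) a = c * Poly_Mapping.lookup x a"
  by (simp add: fscale_def Poly_Mapping.map.rep_eq when_def)

lemma vector_space_fscale: "vector_space (fscale :: 'k::field \<Rightarrow> ('a \<Rightarrow>\<^sub>0 'k) \<Rightarrow> _)"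
  by unfold_locales (auto intro!: poly_mapping_eqI simp: lookup_add algebra_simps)

lemma module_fscale: "module (fscale :: 'k::field \<Rightarrow> ('a \<Rightarrow>\<^sub>0 'k) \<Rightarrow> _)"
  by (rule vector_space_fscale[unfolded module_iff_vector_space[symmetric]])

definition tensor2 :: "'q \<Rightarrow> 'q \<Rightarrow> ('q \<times> 'q) \<Rightarrow>\<^sub>0 'k::field" where
  "tensor2 a b = Poly_Mapping.single (a, b) 1"

definition tensor3 :: "'q \<Rightarrow> 'q \<Rightarrow> 'q \<Rightarrow> ('q \<times> 'q \<times> 'q) \<Rightarrow>\<^sub>0 'k::field" where
  "tensor3 a b c = Poly_Mapping.single (a, b, c) 1"

definition tensor3_rel ::
  "('k::field poly \<Rightarrow> 'q::ab_group_add \<Rightarrow> 'q) \<Rightarrow> 'q set \<Rightarrow> (('q \<times> 'q \<times> 'q) \<Rightarrow>\<^sub>0 'k) set" where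
  "tensor3_rel s Q = module.span fscale
     ({tensor3 (kscale s x a + a') b c - fscale x (tensor3 a b c) - tensor3 a' b c | x a a' b c.
         a \<in> Q \<and> a' \<in> Q \<and> b \<in> Q \<and> c \<in> Q} \<union>
      {tensor3 a (kscale s x b + b') c - fscale x (tensor3 a b c) - tensor3 a b' c | x a b b' c.
         a \<in> Q \<and> b \<in> Q \<and> b' \<in> Q \<and> c \<in> Q} \<union>
      {tensor3 a b (kscale s x c + c') - fscale x (tensor3 a b c) - tensor3 a b c' | x a b c c'.
         a \<in> Q \<and> b \<in> Q \<and> c \<in> Q \<and> c' \<in> Q})"

definition lin_ext :: "('a \<Rightarrow> 'b \<Rightarrow>\<^sub>0 'k::field) \<Rightarrow> ('a \<Rightarrow>\<^sub>0 'k) \<Rightarrow> 'b \<Rightarrow>\<^sub>0 'k" where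
  "lin_ext g x = (\<Sum>a\<in>Poly_Mapping.keys x. fscale (Poly_Mapping.lookup x a) (g a))"

text \<open>\<open>\<partial> \<otimes> I \<otimes> I\<close>, \<open>I \<otimes> \<partial> \<otimes> I\<close> and \<open>I \<otimes> I \<otimes> \<partial>\<close>\<close>

definition pd1 :: "('k::field poly \<Rightarrow> 'q \<Rightarrow> 'q) \<Rightarrow> (('q \<times> 'q \<times> 'q) \<Rightarrow>\<^sub>0 'k) \<Rightarrow> ('q \<times> 'q \<times> 'q) \<Rightarrow>\<^sub>0 'k" where
  "pd1 s = lin_ext (\<lambda>(a, b, c). tensor3 (pd s a) b c)"

definition pd2 :: "('k::field poly \<Rightarrow> 'q \<Rightarrow> 'q) \<Rightarrow> (('q \<times> 'q \<times> 'q) \<Rightarrow>\<^sub>0 'k) \<Rightarrow> ('q \<times> 'q \<times> 'q) \<Rightarrow>\<^sub>0 'k" where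
  "pd2 s = lin_ext (\<lambda>(a, b, c). tensor3 a (pd s b) c)"

definition pd3 :: "('k::field poly \<Rightarrow> 'q \<Rightarrow> 'q) \<Rightarrow> (('q \<times> 'q \<times> 'q) \<Rightarrow>\<^sub>0 'k) \<Rightarrow> ('q \<times> 'q \<times> 'q) \<Rightarrow>\<^sub>0 'k" where
  "pd3 s = lin_ext (\<lambda>(a, b, c). tensor3 a b (pd s c))"

text \<open>The tensor represented by \<open>x\<close> lies in \<open>\<partial>^{\<otimes>3}(Q \<otimes> Q \<otimes> Q)\<close>.\<close>

definition in_pd_image ::
  "('k::field poly \<Rightarrow> 'q::ab_group_add \<Rightarrow> 'q) \<Rightarrow> 'q set \<Rightarrow> (('q \<times> 'q \<times> 'q) \<Rightarrow>\<^sub>0 'k) \<Rightarrow> bool" where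
  "in_pd_image s Q x \<longleftrightarrow>
     (\<exists>y. Poly_Mapping.keys y \<subseteq> Q \<times> Q \<times> Q \<and> x - (pd1 s y + pd2 s y + pd3 s y) \<in> tensor3_rel s Q)"


section \<open>The Poisson conformal Yang-Baxter equation\<close>

text \<open>
  A formal combination \<open>r\<close> with coefficients \<open>w_x\<close> at the pairs \<open>x = (r_x, l_x)\<close> is the tensor
  \<open>\<Sum>x. w_x r_x \<otimes> l_x\<close>; both expressions are bilinear in the summands, which yields the factor
  \<open>w_x w_y\<close>.
\<close>

definition double_sum ::
  "('q \<Rightarrow> 'q \<Rightarrow> 'q \<Rightarrow> 'q \<Rightarrow> ('q \<times> 'q \<times> 'q) \<Rightarrow>\<^sub>0 'k) \<Rightarrow> (('q \<times> 'q) \<Rightarrow>\<^sub>0 'k::field) \<Rightarrow>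
   ('q \<times> 'q \<times> 'q) \<Rightarrow>\<^sub>0 'k" where
  "double_sum g r = (\<Sum>x\<in>Poly_Mapping.keys r. \<Sum>y\<in>Poly_Mapping.keys r.
     fscale (Poly_Mapping.lookup r x * Poly_Mapping.lookup r y) (g (fst x) (snd x) (fst y) (snd y)))"

definition cyb ::
  "('k::field poly \<Rightarrow> 'q::ab_group_add \<Rightarrow> 'q) \<Rightarrow> ('q \<Rightarrow> 'q \<Rightarrow> 'q poly) \<Rightarrow> (('q \<times> 'q) \<Rightarrow>\<^sub>0 'k) \<Rightarrow>
   ('q \<times> 'q \<times> 'q) \<Rightarrow>\<^sub>0 'k" where
  "cyb s br = double_sum (\<lambda>ri li rj lj.
       psubst (pd2 s) (\<lambda>z. tensor3 z li lj) (br ri rj)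
     - psubst (pd3 s) (\<lambda>z. tensor3 ri z lj) (br rj li)
     - psubst (pd2 s) (\<lambda>z. tensor3 ri rj z) (br lj li))"

definition ayb ::
  "('k::field poly \<Rightarrow> 'q::ab_group_add \<Rightarrow> 'q) \<Rightarrow> ('q \<Rightarrow> 'q \<Rightarrow> 'q poly) \<Rightarrow> (('q \<times> 'q) \<Rightarrow>\<^sub>0 'k) \<Rightarrow>
   ('q \<times> 'q \<times> 'q) \<Rightarrow>\<^sub>0 'k" where
  "ayb s pr = double_sum (\<lambda>ri li rj lj.
       psubst (pd1 s) (\<lambda>z. tensor3 ri rj z) (pr li lj)
     - psubst (\<lambda>y. - (pd1 s y + pd2 s y)) (\<lambda>z. tensor3 ri z lj) (pr rj li)
     + psubst (pd2 s) (\<lambda>z. tensor3 z li lj) (pr ri rj))"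

text \<open>\<open>Q\<close> is the carrier of the algebra, a submodule of the module \<open>s\<close>.\<close>

definition pcybe_solution ::
  "('k::field poly \<Rightarrow> 'q::ab_group_add \<Rightarrow> 'q) \<Rightarrow> 'q set \<Rightarrow> ('q \<Rightarrow> 'q \<Rightarrow> 'q poly) \<Rightarrow> ('q \<Rightarrow> 'q \<Rightarrow> 'q poly) \<Rightarrow>
   (('q \<times> 'q) \<Rightarrow>\<^sub>0 'k) \<Rightarrow> bool" where
  "pcybe_solution s Q br pr r \<longleftrightarrow>
     Poly_Mapping.keys r \<subseteq> Q \<times> Q \<and> in_pd_image s Q (cyb s br r) \<and> in_pd_image s Q (ayb s pr r)"

end

theory Submission
  imports Defs
begin

text \<open>
  Write \<open>Q = P \<oplus> P\<^sup>*\<close> and \<open>r = \<Sum>i. (e\<^sub>i \<otimes> f\<^sub>i - f\<^sub>i \<otimes> e\<^sub>i)\<close> with \<open>f\<^sub>i\<close> the dual basis.  Both \<open>[[r,r]]\<close> and \<open>r \<bullet> r\<close> are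
  sums of tensors in which a polynomial \<open>a\<^sub>\<lambda> b\<close> is inserted into one factor while \<open>\<lambda>\<close> acts as the
  derivation on another factor.  Modulo \<open>\<partial>\<^sup>\<otimes>\<^sup>3\<close> the derivations on the three factors sum to zero, and
  the theorem is a cancellation that follows from this relation and from two rules.

  A vector lies in a subspace if every linear functional that kills the subspace kills the vector
  (\<open>in_span_if_functionals_vanish\<close>).  So it is enough to test the two expressions against functionals, that
  is, against trilinear forms \<open>t\<close> on \<open>Q\<close> with \<open>t(\<partial>x,y,z) + t(x,\<partial>y,z) + t(x,y,\<partial>z) = 0\<close>
  (\<open>in_pd_imageI_invariant_form\<close>).  This turns congruences of formal tensors into equations in the
  ground field.  For \<open>q = \<Sum>\<lambda>\<^sup>m q\<^sub>m\<close> denote \<open>\<Sum>\<^sub>m t(q\<^sub>m, \<partial>\<^sup>m y, z)\<close> by \<open>t[q; y; z]\<close>.  The rules are: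

  \<^item> Skew symmetry (\<open>psubst_skew\<close>).  If \<open>q'\<close> arises from \<open>q\<close> by \<open>\<lambda> \<mapsto> -\<lambda>-\<partial>\<close>, then \<open>t[q'; y; z]\<close> is
    \<open>\<Sum>\<^sub>m t(q\<^sub>m, y, \<partial>\<^sup>m z)\<close>: by invariance, \<open>\<partial>\<close> on the third factor is minus the sum of the
    derivations on the first and the second.
  \<^item> Adjointness (\<open>adjoint\<close>).  Summed against the canonical element, the dual representation turns
    into the product: \<open>\<Sum>\<^sub>j t[L\<^sup>*(a) f\<^sub>j; y; e\<^sub>j] = - \<Sum>\<^sub>k t'[a\<^sub>\<lambda> e\<^sub>k; y; f\<^sub>k]\<close>, where \<open>t'(x,y,z) = t(z,y,x)\<close>.

  By these rules each term of either expression becomes, up to sign, \<open>\<Sum>\<^sub>i\<^sub>j \<tau>[e\<^sub>i \<^sub>\<lambda> e\<^sub>j; f\<^sub>i; f\<^sub>j]\<close> for one of the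
  six forms \<open>\<tau>\<close> obtained from \<open>t\<close> by permuting the arguments, and for each \<open>\<tau>\<close> the signs add up to
  zero (\<open>cyb_canonical\<close>, \<open>ayb_canonical\<close>).
\<close>


section \<open>Substitution of operators\<close>

lemma additive_funpow:
  fixes T :: "'a::ab_group_add \<Rightarrow> 'a"
  assumes "additive T" shows "additive (T ^^ k)"
  by (induction k) (use assms in \<open>auto simp: additive_def\<close>)

lemma psubst_altdef:
  assumes "additive T" "h 0 = 0" "degree p \<le> N"
  shows "psubst T h p = (\<Sum>k\<le>N. (T ^^ k) (h (coeff p k)))"
  unfolding psubst_def
proof (rule sum.mono_neutral_left)
  show "\<forall>k\<in>{..N} - {..degree p}. (T ^^ k) (h (coeff p k)) = 0"
    using assms additive.zero[OF additive_funpow[OF assms(1)]]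
    by (auto simp: coeff_eq_0)
qed (use assms in auto)

lemma psubst_0 [simp]: "h 0 = 0 \<Longrightarrow> psubst T h 0 = 0"
  by (simp add: psubst_def)

lemma psubst_pCons:
  assumes "additive T" "h 0 = 0"
  shows "psubst T h (pCons a p) = h a + T (psubst T h p)"
proof -
  have "psubst T h (pCons a p) = (\<Sum>k\<le>Suc (degree p). (T ^^ k) (h (coeff (pCons a p) k)))"
    using assms degree_pCons_le by (intro psubst_altdef)
  also have "\<dots> = h a + (\<Sum>k\<le>degree p. T ((T ^^ k) (h (coeff p k))))"
    by (simp add: sum.atMost_Suc_shift del: sum.atMost_Suc)
  also have "\<dots> = h a + T (psubst T h p)"
    using assms by (simp add: additive.sum psubst_def)
  finally show ?thesis .
qed

lemma psubst_add:
  assumes "additive T" "additive h"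
  shows "psubst T h (p + q) = psubst T h p + psubst T h q"
proof -
  let ?N = "max (degree p) (degree q)"
  have h0: "h 0 = 0" using assms(2) by (rule additive.zero)
  have eq: "psubst T h r = (\<Sum>k\<le>?N. (T ^^ k) (h (coeff r k)))" if "degree r \<le> ?N" for r
    using assms(1) h0 that by (rule psubst_altdef)
  show ?thesis
    by (simp add: eq degree_add_le assms additive.add additive_funpow sum.distrib)
qed

lemma additive_psubst: "additive T \<Longrightarrow> additive h \<Longrightarrow> additive (psubst T h)"
  by (simp add: additive_def psubst_add)

lemma psubst_transfer:
  assumes T: "additive T" and T': "additive T'" and A: "additive A" and h: "h 0 = 0"
    and comm: "\<And>x. A (T x) = T' (A x)"
  shows "A (psubst T h p) = psubst T' (\<lambda>x. A (h x)) p"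
  using h additive.zero[OF A]
  by (induction p rule: pCons_induct)
     (simp_all add: psubst_pCons T T' comm additive.add[OF A])

lemma psubst_map_poly:
  assumes "additive T" "h 0 = 0" "g 0 = 0"
  shows "psubst T h (map_poly g p) = psubst T (\<lambda>x. h (g x)) p"
  by (induction p rule: pCons_induct) (simp_all add: psubst_pCons map_poly_pCons assms)

lemma psubst_sum_fun:
  assumes "additive T" "\<And>k. k \<in> K \<Longrightarrow> h k 0 = 0"
  shows "psubst T (\<lambda>x. \<Sum>k\<in>K. h k x) p = (\<Sum>k\<in>K. psubst T (h k) p)"
proof (induction p rule: pCons_induct)
  case 0
  then show ?case using assms by simp
next
  case (pCons a p)
  then show ?case using assms by (simp add: psubst_pCons additive.sum sum.distrib)
qed

text \<open>
  Substituting commuting operators for the two variables of a polynomial does not depend on which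
  of them is the outer one.  This is needed because \<open>dual_rep_at\<close> has \<open>\<mu>\<close> as outer variable, while the
  coefficients of \<open>dual_rep\<close> are those of \<open>\<lambda>\<close>.
\<close>

lemma psubst_swap_variables:
  fixes K K' :: "'a::zero poly poly"
  assumes T: "additive T" and U: "additive U" and h: "h 0 = 0"
    and comm: "\<And>x. T (U x) = U (T x)"
    and flip: "\<And>m n. coeff (coeff K' m) n = coeff (coeff K n) m"
  shows "psubst T (psubst U h) K' = psubst U (psubst T h) K"
proof -
  define M where "M = (\<lambda>K::'a poly poly. Max (degree ` coeff K ` {..degree K}))"
  define N where "N = degree K + degree K' + M K + M K'"
  have N: "degree K \<le> N" "degree K' \<le> N"
    by (auto simp: N_def)
  have M: "degree (coeff L n) \<le> M L" for L n
  proof (cases "n \<le> degree L")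
    case True then show ?thesis unfolding M_def by (intro Max_ge) auto
  qed (simp add: coeff_eq_0)
  have dK: "degree (coeff K n) \<le> N" for n
    using M[of K n] by (simp add: N_def)
  have dK': "degree (coeff K' n) \<le> N" for n
    using M[of K' n] by (simp add: N_def)
  have pow: "(T ^^ m) ((U ^^ n) x) = (U ^^ n) ((T ^^ m) x)" for m n x
  proof -
    have "T ((U ^^ n) x) = (U ^^ n) (T x)" for x
      by (induction n) (simp_all add: comm)
    then show ?thesis by (induction m) simp_all
  qed
  have "psubst T (psubst U h) K' = (\<Sum>m\<le>N. \<Sum>n\<le>N. (T ^^ m) ((U ^^ n) (h (coeff (coeff K' m) n))))"
    by (simp add: psubst_altdef[OF T _ N(2)] psubst_altdef[of U h _ N] U h dK'
        additive.sum[OF additive_funpow[OF T]])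
  also have "\<dots> = (\<Sum>n\<le>N. \<Sum>m\<le>N. (U ^^ n) ((T ^^ m) (h (coeff (coeff K n) m))))"
    by (subst sum.swap) (simp add: flip pow)
  also have "\<dots> = psubst U (psubst T h) K"
    by (simp add: psubst_altdef[OF U _ N(1)] psubst_altdef[of T h _ N] T h dK
        additive.sum[OF additive_funpow[OF U]])
  finally show ?thesis .
qed


section \<open>Moving the derivation between two arguments\<close>

text \<open>
  For a family of bilinear forms \<open>h x\<close>, the form \<open>psubst (on_fst D) h q\<close> sends \<open>(b, c)\<close> to
  \<open>\<Sum>m. h q\<^sub>m (D\<^sup>m b) c\<close>.  Substituting operators on forms, instead of writing out these sums, lets the rules
  for \<open>psubst\<close> do the bookkeeping of degrees.
\<close>

definition on_fst :: "('b \<Rightarrow> 'b) \<Rightarrow> ('b \<Rightarrow> 'c \<Rightarrow> 'k) \<Rightarrow> 'b \<Rightarrow> 'c \<Rightarrow> 'k" where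
  "on_fst D \<beta> = (\<lambda>b c. \<beta> (D b) c)"

definition on_snd :: "('c \<Rightarrow> 'c) \<Rightarrow> ('b \<Rightarrow> 'c \<Rightarrow> 'k) \<Rightarrow> 'b \<Rightarrow> 'c \<Rightarrow> 'k" where
  "on_snd D \<beta> = (\<lambda>b c. \<beta> b (D c))"

lemma additive_on_fst [simp]: "additive (on_fst D :: _ \<Rightarrow> _ \<Rightarrow> _ \<Rightarrow> 'k::ab_group_add)"
  and additive_on_snd [simp]: "additive (on_snd D' :: _ \<Rightarrow> _ \<Rightarrow> _ \<Rightarrow> 'k::ab_group_add)"
  by (auto simp: additive_def on_fst_def on_snd_def plus_fun_def)

lemma psubst_on_fst:
  "psubst (on_fst D) h q b c = (\<Sum>m\<le>degree q. h (coeff q m) ((D ^^ m) b) c)"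
  for h :: "_ \<Rightarrow> _ \<Rightarrow> _ \<Rightarrow> 'k::ab_group_add"
proof -
  have 1: "(on_fst D ^^ m) \<beta> = (\<lambda>b c. \<beta> ((D ^^ m) b) c)" for m and \<beta> :: "_ \<Rightarrow> _ \<Rightarrow> 'k"
    by (induction m arbitrary: \<beta>) (simp_all add: on_fst_def funpow_swap1)
  have 2: "(\<Sum>m\<in>M. f m) b c = (\<Sum>m\<in>M. f m b c)" for M :: "nat set" and f :: "nat \<Rightarrow> _ \<Rightarrow> _ \<Rightarrow> 'k"
    by (induction M rule: infinite_finite_induct) auto
  show ?thesis by (simp add: psubst_def 1 2)
qed

lemma psubst_on_snd:
  "psubst (on_snd D) h q b c = psubst (on_fst D) (\<lambda>x b c. h x c b) q c b"
  for h :: "_ \<Rightarrow> _ \<Rightarrow> _ \<Rightarrow> 'k::ab_group_add"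
proof -
  have 1: "(on_snd D ^^ m) \<beta> = (\<lambda>b c. \<beta> b ((D ^^ m) c))" for m and \<beta> :: "_ \<Rightarrow> _ \<Rightarrow> 'k"
    by (induction m arbitrary: \<beta>) (simp_all add: on_snd_def funpow_swap1)
  have 2: "(\<Sum>m\<in>M. f m) b c = (\<Sum>m\<in>M. f m b c)" for M :: "nat set" and f :: "nat \<Rightarrow> _ \<Rightarrow> _ \<Rightarrow> 'k"
    by (induction M rule: infinite_finite_induct) auto
  show ?thesis unfolding psubst_on_fst by (simp add: psubst_def 1 2)
qed

lemma additive_skew_step:
  assumes pd: "additive (pd s)"
  shows "additive (\<lambda>F. - pCons 0 F - map_poly (pd s) F)"
proof -
  have "map_poly (pd s) (F + G) = map_poly (pd s) F + map_poly (pd s) G" for F G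
    by (rule poly_eqI) (simp add: coeff_map_poly additive.zero[OF pd] additive.add[OF pd])
  moreover have "pCons 0 (F + G) = pCons 0 F + pCons 0 G" for F G :: "'b poly"
    by simp
  ultimately show ?thesis
    unfolding additive_def by (simp only: algebra_simps) simp
qed

text \<open>
  The coefficients of \<open>skew s q\<close> are those of \<open>(-\<lambda>-\<partial>)\<^sup>m q\<^sub>m\<close>.  Here \<open>\<lambda>\<close> acts as \<open>D\<close> on \<open>b\<close>, and by
  invariance \<open>\<partial>\<close> on the inserted coefficient is minus \<open>D\<close> on \<open>b\<close> minus \<open>D\<close> on \<open>c\<close>; so \<open>-\<lambda>-\<partial>\<close> acts
  as \<open>D\<close> on \<open>c\<close>.
\<close>

lemma psubst_skew:
  fixes h :: "'v::ab_group_add \<Rightarrow> 'q \<Rightarrow> 'q \<Rightarrow> 'k::field"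
  assumes h: "additive h" and pd: "additive (pd s)"
    and inv: "\<And>x b c. h (pd s x) b c + h x (D b) c + h x b (D c) = 0"
  shows "psubst (on_fst D) h (skew s q) = psubst (on_snd D) h q"
proof -
  let ?A = "psubst (on_fst D) h"
  have A: "additive ?A" using h by (intro additive_psubst) auto
  have h0: "h 0 = 0" using h by (rule additive.zero)
  have inv': "h (pd s x) = - on_fst D (h x) - on_snd D (h x)" for x
    using inv[of x] by (intro ext) (simp add: on_fst_def on_snd_def algebra_simps eq_neg_iff_add_eq_0)
  let ?B = "\<lambda>\<beta>. - on_fst D \<beta> - on_snd D \<beta>"
  have B: "additive ?B" by (auto simp: additive_def on_fst_def on_snd_def fun_eq_iff)
  have comm: "?B (on_fst D \<beta>) = on_fst D (?B \<beta>)" for \<beta> :: "'q \<Rightarrow> 'q \<Rightarrow> 'k"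
    by (auto simp: on_fst_def on_snd_def fun_eq_iff)
  have step: "?A (- pCons 0 F - map_poly (pd s) F) = on_snd D (?A F)" for F
  proof -
    have "?A (map_poly (pd s) F) = ?B (?A F)"
      using psubst_transfer[of "on_fst D" "on_fst D" ?B h F, OF additive_on_fst additive_on_fst B h0 comm] h0
      by (simp add: psubst_map_poly additive.zero[OF pd] inv')
    moreover have "?A (pCons 0 F) = on_fst D (?A F)"
      by (simp add: psubst_pCons h0)
    ultimately show ?thesis
      by (simp only: additive.diff[OF A] additive.minus[OF A]) simp
  qed
  have "?A (skew s q) = psubst (on_snd D) (\<lambda>x. ?A [:x:]) q"
    unfolding skew_def
    by (rule psubst_transfer[of "\<lambda>F. - pCons 0 F - map_poly (pd s) F" "on_snd D" ?A "\<lambda>v. [:v:]" q,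
          OF additive_skew_step[OF pd] additive_on_snd A _ step]) simp
  also have "(\<lambda>x. ?A [:x:]) = h"
    by (simp add: psubst_pCons h0 additive.zero[OF additive_on_fst])
  finally show ?thesis .
qed


section \<open>The conformal dual\<close>

lemma kscale_triv_scale [simp]: "kscale triv_scale c = (*) c"
  by (auto simp: kscale_def triv_scale_def)

lemma pd_triv_scale [simp]: "pd triv_scale x = 0"
  by (simp add: pd_def triv_scale_def)

lemma kscale_Chom_scale [simp]: "kscale (Chom_scale triv_scale) c g = (\<lambda>u. smult c (g u))"
  by (simp add: kscale_def Chom_scale_def psubst_def smult_conv_map_poly)

lemma pd_Chom_scale [simp]: "pd (Chom_scale triv_scale) g = (\<lambda>u. - pCons 0 (g u))"
  by (simp add: pd_def Chom_scale_def psubst_def smult_conv_map_poly[symmetric])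

lemma map_poly_zero_fun [simp]: "map_poly (\<lambda>x. 0) p = 0"
  by (rule poly_eqI) (simp add: coeff_map_poly)

text \<open>
  Conformal linear maps to the trivial module are the \<open>k[\<partial>]\<close>-linear maps to \<open>k[\<lambda>]\<close> on which \<open>\<partial>\<close> acts
  as multiplication by \<open>\<lambda>\<close>; this is what \<open>cdual_scale\<close> records.
\<close>

lemma cdual_iff:
  "f \<in> cdual s \<longleftrightarrow> (\<forall>u u'. f (u + u') = f u + f u') \<and> (\<forall>c u. f (kscale s c u) = smult c (f u)) \<and>
     (\<forall>u. f (pd s u) = pCons 0 (f u))"
  by (simp add: cdual_def Chom_def smult_conv_map_poly pd_triv_scale[abs_def])

lemma cdual_additive: "f \<in> cdual s \<Longrightarrow> additive f"
  by (simp add: cdual_iff additive_def)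

context kd_module
begin

lemma additive_pd: "additive (pd s)"
  by (simp add: additive_def pd_def scale_right_distrib)

lemma additive_kscale: "additive (kscale s c)"
  by (simp add: additive_def kscale_def scale_right_distrib)

lemma scale_pCons: "s (pCons c p) u = kscale s c u + s p (pd s u)"
proof -
  have "pCons c p = [:c:] + p * [:0, 1:]" by simp
  then show ?thesis
    by (simp only: scale_left_distrib scale_scale[symmetric] kscale_def pd_def)
qed

lemma cdual_scale:
  assumes "f \<in> cdual s"
  shows "f (s p u) = p * f u"
proof (induction p arbitrary: u)
  case 0
  then show ?case
    using additive.zero[OF cdual_additive[OF assms]] by simp
next
  case (pCons c p)
  then show ?case
    using assms by (simp add: scale_pCons cdual_iff)
qed

end

locale based_module = kd_module s
  for s :: "'k::field_char_0 poly \<Rightarrow> 'v::ab_group_add \<Rightarrow> 'v" +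
  fixes n :: nat and e :: "nat \<Rightarrow> 'v" and e' :: "nat \<Rightarrow> 'v \<Rightarrow> 'k poly"
  assumes basis: "kd_basis s n e" and dual: "dual_basis s n e e'"
begin

lemma dual_in_cdual: "i \<in> {1..n} \<Longrightarrow> e' i \<in> cdual s"
  using dual by (simp add: dual_basis_def)

lemma dual_apply: "i \<in> {1..n} \<Longrightarrow> j \<in> {1..n} \<Longrightarrow> e' i (e j) = (if i = j then 1 else 0)"
  using dual by (simp add: dual_basis_def)

text \<open>
  By \<open>cdual_scale\<close> the value \<open>e' k u\<close>, read as a polynomial in \<open>\<partial>\<close>, is the \<open>k\<close>-th coordinate of \<open>u\<close>.
\<close>

lemma coordinates: "(\<Sum>k=1..n. s (e' k u) (e k)) = u"
proof -
  have "u \<in> span (e ` {1..n})"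
    using basis by (simp add: kd_basis_def)
  then show ?thesis
  proof (induction rule: span_induct_alt)
    case base
    have "e' k 0 = 0" if "k \<in> {1..n}" for k
      using dual_in_cdual[OF that] by (rule additive.zero[OF cdual_additive])
    then show ?case by simp
  next
    case (step p v w)
    then obtain j where j: "j \<in> {1..n}" "v = e j" by auto
    have "e' k (s p v + w) = (if k = j then p else 0) + e' k w" if "k \<in> {1..n}" for k
      using that j dual_in_cdual[OF that]
      by (simp add: cdual_iff[of "e' k"] cdual_scale dual_apply)
    then have "(\<Sum>k=1..n. s (e' k (s p v + w)) (e k))
        = (\<Sum>k=1..n. (if k = j then s p (e j) else 0)) + (\<Sum>k=1..n. s (e' k w) (e k))"
      unfolding sum.distrib[symmetric]
      by (intro sum.cong) (auto simp: scale_left_distrib)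
    then show ?case using j step by simp
  qed
qed

lemma cdual_expansion:
  assumes "g \<in> cdual s"
  shows "(\<Sum>k=1..n. g (e k) * e' k u) = g u"
proof -
  have "g u = g (\<Sum>k=1..n. s (e' k u) (e k))"
    by (simp only: coordinates)
  also have "\<dots> = (\<Sum>k=1..n. e' k u * g (e k))"
    using assms module_axioms by (simp add: additive.sum[OF cdual_additive[OF assms]] cdual_scale)
  finally show ?thesis by (simp add: mult.commute)
qed

end


section \<open>The dual representation\<close>

lemma lam_0 [simp]: "lam 0 = 0" by (simp add: lam_def)

lemma coeff_lam: "coeff (lam K) n = pCons 0 (coeff K n)"
  by (simp add: lam_def coeff_map_poly)

lemma additive_lam: "additive lam"
  by (auto simp: additive_def poly_eq_iff coeff_lam coeff_pCons split: nat.split)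

lemma additive_mu: "additive mu"
  by (simp add: additive_def mu_def)

lemma lam_mu: "lam (mu K) = mu (lam K)"
  by (simp add: mu_def lam_def map_poly_pCons)

lemma additive_mu_lam: "additive (\<lambda>F. mu F - lam F)"
  by (simp add: additive_def additive.add[OF additive_lam] additive.add[OF additive_mu])

text \<open>
  \<open>shifted p\<close> is \<open>p(\<mu>-\<lambda>)\<close>.
\<close>

definition shifted :: "'k::comm_ring_1 poly \<Rightarrow> 'k poly poly" where
  "shifted = psubst (\<lambda>F. mu F - lam F) (\<lambda>c. [:[:c:]:])"

lemma additive_shifted: "additive shifted"
  unfolding shifted_def by (intro additive_psubst additive_mu_lam) (simp add: additive_def)

lemma shifted_pCons: "shifted (pCons c p) = [:[:c:]:] + (mu (shifted p) - lam (shifted p))"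
  unfolding shifted_def by (subst psubst_pCons) (simp_all add: additive_mu_lam)

lemma shifted_smult: "shifted (smult c p) = smult [:c:] (shifted p)"
proof (induction p)
  case 0 then show ?case by (simp add: additive.zero[OF additive_shifted])
next
  case (pCons a p)
  have "lam (smult [:c:] K) = smult [:c:] (lam K)" for K
    by (auto simp: poly_eq_iff coeff_lam coeff_pCons split: nat.split)
  with pCons show ?case
    by (simp add: shifted_pCons smult_add_right smult_diff_right mu_def)
qed

lemma dual_rep_at_shifted: "dual_rep_at \<phi> a f u = - psubst lam (\<lambda>x. shifted (f x)) (\<phi> a u)"
  by (simp add: dual_rep_at_def shifted_def)

text \<open>
  The sequence to which \<open>Abs_poly\<close> is applied in \<open>dual_rep\<close>.
\<close>

definition dual_rep_coeff ::
  "('p \<Rightarrow> 'v \<Rightarrow> 'v::ab_group_add poly) \<Rightarrow> 'p \<Rightarrow> ('v \<Rightarrow> 'k::comm_ring_1 poly) \<Rightarrow> nat \<Rightarrow> 'v \<Rightarrow> 'k poly" where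
  "dual_rep_coeff \<phi> a f m u = map_poly (\<lambda>q. coeff q m) (dual_rep_at \<phi> a f u)"

lemma coeff_dual_rep_coeff: "coeff (dual_rep_coeff \<phi> a f m u) l = coeff (coeff (dual_rep_at \<phi> a f u) l) m"
  by (simp add: dual_rep_coeff_def coeff_map_poly)

context conformal_product
begin

lemma additive_left: "additive (\<lambda>a. m a b)" and additive_right: "additive (m a)"
  by (simp_all add: additive_def add_left add_right)

context
  fixes f assumes f: "f \<in> cdual s"
begin

lemma additive_shifted_cdual: "additive (\<lambda>x. shifted (f x))"
  by (simp add: additive_def additive.add[OF additive_shifted] additive.add[OF cdual_additive[OF f]])

lemma shifted_cdual_0: "shifted (f 0) = 0"
  by (rule additive.zero[OF additive_shifted_cdual])

lemma dual_rep_at_add: "dual_rep_at m a f (u + v) = dual_rep_at m a f u + dual_rep_at m a f v"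
  by (simp add: dual_rep_at_shifted add_right psubst_add additive_lam additive_shifted_cdual)

lemma dual_rep_at_kscale: "dual_rep_at m a f (kscale s c u) = smult [:c:] (dual_rep_at m a f u)"
proof -
  have 1: "lam (smult [:c:] K) = smult [:c:] (lam K)" for K
    by (auto simp: poly_eq_iff coeff_lam coeff_pCons split: nat.split)
  have "psubst lam (\<lambda>x. shifted (f x)) (map_poly (kscale s c) (m a u))
      = psubst lam (\<lambda>x. smult [:c:] (shifted (f x))) (m a u)"
    using f by (simp add: psubst_map_poly additive_lam shifted_cdual_0 additive.zero[OF additive_kscale]
        cdual_iff shifted_smult)
  also have "\<dots> = smult [:c:] (psubst lam (\<lambda>x. shifted (f x)) (m a u))"
    by (rule psubst_transfer[symmetric, OF additive_lam additive_lam])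
       (simp_all add: shifted_cdual_0 1 additive_def smult_add_right)
  finally show ?thesis
    by (simp add: dual_rep_at_shifted scale_right)
qed

text \<open>
  On \<open>\<phi>(a)\<^sub>\<lambda> u\<close> the derivation of \<open>u\<close> acts as \<open>\<partial>+\<lambda>\<close>, and \<open>f\<^sub>\<mu>\<^sub>-\<^sub>\<lambda>\<close> turns \<open>\<partial>\<close> into \<open>\<mu>-\<lambda>\<close>; the two \<open>\<lambda>\<close> cancel.
\<close>

lemma dual_rep_at_pd: "dual_rep_at m a f (pd s u) = mu (dual_rep_at m a f u)"
proof -
  let ?A = "\<lambda>F. mu F - lam F"
  have comm: "?A (lam K) = lam (?A K)" for K :: "'k poly poly"
    by (simp add: additive.diff[OF additive_lam] lam_mu)
  have "psubst lam (\<lambda>x. shifted (f x)) (map_poly (pd s) (m a u))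
      = psubst lam (\<lambda>x. ?A (shifted (f x))) (m a u)"
    using f by (simp add: psubst_map_poly additive_lam shifted_cdual_0 additive.zero[OF additive_pd]
        cdual_iff shifted_pCons)
  also have "\<dots> = ?A (psubst lam (\<lambda>x. shifted (f x)) (m a u))"
    by (rule psubst_transfer[symmetric, OF additive_lam additive_lam additive_mu_lam])
       (simp_all add: shifted_cdual_0 comm)
  finally show ?thesis
    by (simp add: dual_rep_at_shifted sesqui_right psubst_add additive_lam additive_shifted_cdual
        psubst_pCons shifted_cdual_0 additive.minus[OF additive_mu])
qed

lemma dual_rep_coeff_cdual: "dual_rep_coeff m a f l \<in> cdual s"
  unfolding cdual_iff
  by (auto simp: poly_eq_iff coeff_dual_rep_coeff dual_rep_at_add dual_rep_at_kscale dual_rep_at_pd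
      mu_def coeff_pCons split: nat.split)

end

end

locale based_conformal_product = conformal_product s m + based_module s n e e'
  for s :: "'k::field_char_0 poly \<Rightarrow> 'v::ab_group_add \<Rightarrow> 'v" and m n e e'
begin

text \<open>
  \<open>Abs_poly\<close> is meaningful only on sequences of finite support.  Each \<open>dual_rep_coeff m a f l\<close> is
  conformal linear, hence determined by its values on the basis, and these vanish once \<open>l\<close> exceeds
  all degrees in \<open>\<lambda>\<close> that occur at the finitely many basis elements.
\<close>

lemma coeff_dual_rep:
  assumes f: "f \<in> cdual s"
  shows "coeff (dual_rep m a f) l = dual_rep_coeff m a f l"
proof -
  define N where "N = Max (\<Union>k\<in>{1..n}. degree ` set (coeffs (dual_rep_at m a f (e k))))"
  have "dual_rep_coeff m a f l = 0" if "l > N" for l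
  proof
    fix u
    have "dual_rep_coeff m a f l (e k) = 0" if k: "k \<in> {1..n}" for k
    proof (rule poly_eqI)
      fix i
      let ?q = "coeff (dual_rep_at m a f (e k)) i"
      have "coeff ?q l = 0"
      proof (cases "?q = 0")
        case False
        then have "?q \<in> set (coeffs (dual_rep_at m a f (e k)))"
          using le_degree[of "dual_rep_at m a f (e k)" i] by (intro coeff_in_coeffs) auto
        then have "degree ?q \<le> N"
          unfolding N_def using k by (intro Max_ge) auto
        with \<open>l > N\<close> show ?thesis by (simp add: coeff_eq_0)
      qed simp
      then show "coeff (dual_rep_coeff m a f l (e k)) i = coeff 0 i"
        by (simp add: coeff_dual_rep_coeff)
    qed
    then show "dual_rep_coeff m a f l u = 0 u"
      using cdual_expansion[OF dual_rep_coeff_cdual[OF f], of a l u] by simp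
  qed
  then have "\<forall>\<^sub>\<infinity>l. dual_rep_coeff m a f l = 0"
    by (auto simp: MOST_nat)
  moreover have "dual_rep m a f = Abs_poly (dual_rep_coeff m a f)"
    by (simp add: dual_rep_def dual_rep_coeff_def[abs_def])
  ultimately show ?thesis
    by (simp add: Abs_poly_inverse)
qed

end


section \<open>Invariant trilinear forms\<close>

definition on_both :: "('q \<Rightarrow> 'q) \<Rightarrow> ('q \<Rightarrow> 'q \<Rightarrow> 'k::plus) \<Rightarrow> 'q \<Rightarrow> 'q \<Rightarrow> 'k" where
  "on_both D \<beta> = on_fst D \<beta> + on_snd D \<beta>"

lemma additive_on_both: "additive (on_both D :: _ \<Rightarrow> _ \<Rightarrow> _ \<Rightarrow> 'k::ab_group_add)"
  by (auto simp: additive_def on_both_def on_fst_def on_snd_def fun_eq_iff)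

lemma on_both_on_fst: "on_both D (on_fst D \<beta>) = on_fst D (on_both D \<beta>)"
  by (auto simp: on_both_def on_fst_def on_snd_def fun_eq_iff)

definition scaled_form :: "('q \<Rightarrow> 'q \<Rightarrow> 'k::times) \<Rightarrow> 'k \<Rightarrow> 'q \<Rightarrow> 'q \<Rightarrow> 'k" where
  "scaled_form \<beta> c = (\<lambda>x y. c * \<beta> x y)"

lemma additive_scaled_form: "additive (scaled_form \<beta> :: 'k::comm_ring \<Rightarrow> _)"
  by (auto simp: additive_def scaled_form_def fun_eq_iff algebra_simps)

lemma scaled_form_0 [simp]: "scaled_form \<beta> (0::'k::comm_ring) = 0"
  by (rule additive.zero[OF additive_scaled_form])

text \<open>
  \<open>act_lam_mu D \<beta> K\<close> is the bilinear form \<open>K(D \<otimes> 1, D \<otimes> 1 + 1 \<otimes> D) \<beta>\<close>.  With this action \<open>\<mu>-\<lambda>\<close> becomes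
  \<open>1 \<otimes> D\<close>, which is why the shift in the dual representation turns into the module action on the third
  argument.
\<close>

definition act_lam_mu :: "('q \<Rightarrow> 'q) \<Rightarrow> ('q \<Rightarrow> 'q \<Rightarrow> 'k::comm_ring_1) \<Rightarrow> 'k poly poly \<Rightarrow> 'q \<Rightarrow> 'q \<Rightarrow> 'k" where
  "act_lam_mu D \<beta> = psubst (on_both D) (psubst (on_fst D) (scaled_form \<beta>))"

lemma additive_act_lam_mu: "additive (act_lam_mu D \<beta>)"
  unfolding act_lam_mu_def
  by (intro additive_psubst additive_on_both additive_on_fst additive_scaled_form)

lemma act_lam_mu_mu: "act_lam_mu D \<beta> (mu K) = on_both D (act_lam_mu D \<beta> K)"
  unfolding act_lam_mu_def mu_def by (subst psubst_pCons) (simp_all add: additive_on_both)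

lemma act_lam_mu_lam: "act_lam_mu D \<beta> (lam K) = on_fst D (act_lam_mu D \<beta> K)"
proof -
  have "act_lam_mu D \<beta> (lam K) = psubst (on_both D) (\<lambda>q. on_fst D (psubst (on_fst D) (scaled_form \<beta>) q)) K"
    unfolding act_lam_mu_def lam_def
    by (simp add: psubst_map_poly additive_on_both psubst_pCons)
  also have "\<dots> = on_fst D (act_lam_mu D \<beta> K)"
    unfolding act_lam_mu_def
    by (rule psubst_transfer[symmetric, OF additive_on_both additive_on_both additive_on_fst])
       (simp_all add: on_both_on_fst)
  finally show ?thesis .
qed

lemma act_lam_mu_shifted: "act_lam_mu D \<beta> (shifted p) = psubst (on_snd D) (scaled_form \<beta>) p"
proof -
  have "act_lam_mu D \<beta> (shifted p) = psubst (on_snd D) (\<lambda>c. act_lam_mu D \<beta> [:[:c:]:]) p"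
    unfolding shifted_def
    by (rule psubst_transfer[OF additive_mu_lam additive_on_snd additive_act_lam_mu])
       (simp_all add: additive.diff[OF additive_act_lam_mu] act_lam_mu_mu act_lam_mu_lam on_both_def)
  also have "(\<lambda>c. act_lam_mu D \<beta> [:[:c:]:]) = scaled_form \<beta>"
    by (simp add: act_lam_mu_def psubst_pCons additive_on_both additive.zero[OF additive_on_both]
        additive.zero[OF additive_on_fst])
  finally show ?thesis .
qed

lemma pd_sd_scale: "pd (sd_scale s t) x = (pd s (fst x), pd t (snd x))"
  by (simp add: pd_def sd_scale_def)

lemma kscale_sd_scale: "kscale (sd_scale s t) c x = (kscale s c (fst x), kscale t c (snd x))"
  by (simp add: kscale_def sd_scale_def)

lemma sum_pair_fst: "(\<Sum>j\<in>J. (F j, 0)) = (\<Sum>j\<in>J. F j, 0)"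
  and sum_pair_snd: "(\<Sum>j\<in>J. (0, G j)) = (0, \<Sum>j\<in>J. G j)"
  by (induction J rule: infinite_finite_induct) (auto simp: zero_prod_def)

lemma sum_fun_apply: "(\<Sum>j\<in>J. F j) x = (\<Sum>j\<in>J. F j x)"
  by (induction J rule: infinite_finite_induct) auto

locale invariant_form =
  fixes S :: "'k::field poly \<Rightarrow> 'q::ab_group_add \<Rightarrow> 'q" and t :: "'q \<Rightarrow> 'q \<Rightarrow> 'q \<Rightarrow> 'k"
  assumes add1: "t (x + x') y z = t x y z + t x' y z"
    and add2: "t x (y + y') z = t x y z + t x y' z"
    and add3: "t x y (z + z') = t x y z + t x y z'"
    and scale1: "t (kscale S c x) y z = c * t x y z"
    and scale2: "t x (kscale S c y) z = c * t x y z"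
    and scale3: "t x y (kscale S c z) = c * t x y z"
    and inv: "t (pd S x) y z + t x (pd S y) z + t x y (pd S z) = 0"
begin

lemma swap23: "invariant_form S (\<lambda>x y z. t x z y)"
proof (unfold_locales, goal_cases)
  case (7 x y z)
  then show ?case using inv[of x z y] by (simp add: add_ac)
qed (simp_all add: add1 add2 add3 scale1 scale2 scale3)

lemma swap12: "invariant_form S (\<lambda>x y z. t y x z)"
proof (unfold_locales, goal_cases)
  case (7 x y z)
  then show ?case using inv[of y x z] by (simp add: add_ac)
qed (simp_all add: add1 add2 add3 scale1 scale2 scale3)

lemma additive1: "additive t"
  by (simp add: additive_def add1 fun_eq_iff)

lemma additive3: "additive (t x y)"
  by (simp add: additive_def add3)

end

lemma invariant_form_permuted:
  assumes "invariant_form S t"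
  shows "invariant_form S (\<lambda>x y z. t x z y)" "invariant_form S (\<lambda>x y z. t y x z)"
    "invariant_form S (\<lambda>x y z. t z x y)" "invariant_form S (\<lambda>x y z. t z y x)"
    "invariant_form S (\<lambda>x y z. t y z x)"
proof -
  show "invariant_form S (\<lambda>x y z. t x z y)" and 12: "invariant_form S (\<lambda>x y z. t y x z)"
    using assms by (rule invariant_form.swap23, rule invariant_form.swap12)
  from 12 show 312: "invariant_form S (\<lambda>x y z. t z x y)"
    by (rule invariant_form.swap23)
  from 312 show 13: "invariant_form S (\<lambda>x y z. t z y x)"
    by (rule invariant_form.swap12)
  from 13 show "invariant_form S (\<lambda>x y z. t y z x)"
    by (rule invariant_form.swap23)
qed

context based_conformal_product
begin

abbreviation S where "S \<equiv> sd_scale s (Chom_scale triv_scale :: 'k poly \<Rightarrow> ('v \<Rightarrow> 'k poly) \<Rightarrow> _)"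

abbreviation D where "D \<equiv> pd S"

context
  fixes t :: "'v \<times> ('v \<Rightarrow> 'k poly) \<Rightarrow> 'v \<times> ('v \<Rightarrow> 'k poly) \<Rightarrow> 'v \<times> ('v \<Rightarrow> 'k poly) \<Rightarrow> 'k"
  assumes t: "invariant_form S t"
begin

interpretation t: invariant_form S t by (rule t)

text \<open>
  On the dual, \<open>-\<partial>\<close> is multiplication by \<open>\<lambda>\<close>, and by invariance it is transferred to the sum of the
  derivations on the two other arguments.
\<close>

lemma form_mult_dual: "t (0, \<lambda>u. p * g u) = psubst (on_both D) (scaled_form (t (0, g))) p"
proof (induction p)
  case 0
  then show ?case
    using additive.zero[OF t.additive1] by (simp add: zero_prod_def zero_fun_def)
next
  case (pCons a p)
  have "(0, \<lambda>u. pCons a p * g u) = kscale S a (0, g) - D (0, \<lambda>u. p * g u)"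
    by (simp add: kscale_sd_scale pd_sd_scale fun_eq_iff additive.zero[OF additive_kscale] additive.zero[OF additive_pd])
  moreover have "t (kscale S a x) = scaled_form (t x) a" for x
    by (simp add: scaled_form_def fun_eq_iff t.scale1)
  moreover have "t (D x) = - on_both D (t x)" for x
  proof (intro ext)
    fix y z
    have "t (D x) y z = - (t x (D y) z + t x y (D z))"
      using t.inv[of x y z] by (simp only: add.assoc eq_neg_iff_add_eq_0)
    then show "t (D x) y z = (- on_both D (t x)) y z"
      by (simp add: on_both_def on_fst_def on_snd_def)
  qed
  ultimately have "t (0, \<lambda>u. pCons a p * g u) = scaled_form (t (0, g)) a + on_both D (t (0, \<lambda>u. p * g u))"
    by (simp only: additive.diff[OF t.additive1] diff_minus_eq_add)
  then show ?case
    by (simp only: pCons.IH psubst_pCons additive_on_both scaled_form_0)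
qed

lemma form_scale: "psubst (on_snd D) (scaled_form (t x)) p y (u, 0) = t x y (s p u, 0)"
proof (induction p arbitrary: u)
  case 0
  have "t x y (0, 0) = 0"
    using additive.zero[OF t.additive3, of x y] by (simp only: zero_prod_def)
  then show ?case by (simp add: zero_fun_def)
next
  case (pCons a p)
  have *: "(s (pCons a p) u, 0) = kscale S a (u, 0) + (s p (pd s u), 0)"
    by (simp add: kscale_sd_scale scale_pCons fun_eq_iff)
  have "psubst (on_snd D) (scaled_form (t x)) (pCons a p) y (u, 0)
      = scaled_form (t x) a y (u, 0) + psubst (on_snd D) (scaled_form (t x)) p y (pd s u, 0)"
    by (simp add: psubst_pCons on_snd_def pd_sd_scale)
       (simp add: zero_fun_def)
  also have "\<dots> = t x y (s (pCons a p) u, 0)"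
    unfolding * by (simp only: pCons.IH scaled_form_def t.add3 t.scale3)
  finally show ?case .
qed

text \<open>
  Expanding the coefficients of \<open>dual_rep m a (e' j)\<close> in the dual basis and transferring their
  coordinates to the other arguments gives \<open>- \<Sum>k. t(f\<^sub>k, \<partial>\<^sup>l y, p(\<partial>) e\<^sub>j)\<close> with \<open>p\<close> the \<open>j\<close>-th coordinate of
  the \<open>l\<close>-th coefficient of \<open>a\<^sub>\<lambda> e\<^sub>k\<close>.  The sum over \<open>j\<close> reassembles that coefficient from its coordinates.
\<close>

lemma adjoint:
  "(\<Sum>j=1..n. psubst (on_fst D) (\<lambda>g. t (0, g)) (dual_rep m a (e' j)) y (e j, 0))
    = - (\<Sum>k=1..n. psubst (on_fst D) (\<lambda>u y z. t z y (u, 0)) (m a (e k)) y (0, e' k))"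
proof -
  let ?h = "\<lambda>k. scaled_form (t (0, e' k))"
  \<comment> \<open>The dual basis coordinates of a coefficient of \<open>dual_rep\<close> are polynomials in \<open>\<mu>\<close>, so expanding all
     coefficients amounts to substituting for both variables of \<open>dual_rep_at\<close>.\<close>
  have 1: "psubst (on_fst D) (\<lambda>g. t (0, g)) (dual_rep m a f)
       = - (\<Sum>k=1..n. psubst (on_fst D) (\<lambda>u. psubst (on_snd D) (?h k) (f u)) (m a (e k)))"
    if f: "f \<in> cdual s" for f
  proof -
    let ?d = "dual_rep m a f"
    have "t (0, coeff ?d l) = (\<Sum>k=1..n. psubst (on_both D) (?h k) (coeff ?d l (e k)))" for l
    proof -
      have "coeff ?d l \<in> cdual s"
        using f by (simp add: coeff_dual_rep dual_rep_coeff_cdual)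
      then have "(0, coeff ?d l) = (\<Sum>k=1..n. (0, \<lambda>u. coeff ?d l (e k) * e' k u))"
        using cdual_expansion[of "coeff ?d l"] by (simp only: sum_pair_snd) (simp add: fun_eq_iff sum_fun_apply)
      then have "t (0, coeff ?d l) = t (\<Sum>k=1..n. (0, \<lambda>u. coeff ?d l (e k) * e' k u))"
        by (rule arg_cong)
      also have "\<dots> = (\<Sum>k=1..n. t (0, \<lambda>u. coeff ?d l (e k) * e' k u))"
        by (rule additive.sum[OF t.additive1])
      finally show ?thesis
        by (simp only: form_mult_dual)
    qed
    then have "psubst (on_fst D) (\<lambda>g. t (0, g)) ?d
        = psubst (on_fst D) (\<lambda>g. \<Sum>k=1..n. psubst (on_both D) (?h k) (g (e k))) ?d"
      by (simp add: psubst_def)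
    also have "\<dots> = (\<Sum>k=1..n. psubst (on_fst D) (\<lambda>g. psubst (on_both D) (?h k) (g (e k))) ?d)"
      by (rule psubst_sum_fun) simp_all
    also have "\<dots> = (\<Sum>k=1..n. psubst (on_fst D) (psubst (on_both D) (?h k)) (map_poly (\<lambda>g. g (e k)) ?d))"
      by (simp add: psubst_map_poly)
    also have "\<dots> = (\<Sum>k=1..n. act_lam_mu D (t (0, e' k)) (dual_rep_at m a f (e k)))"
      unfolding act_lam_mu_def
      by (intro sum.cong refl psubst_swap_variables)
         (simp_all add: additive_on_both on_both_on_fst coeff_map_poly coeff_dual_rep f coeff_dual_rep_coeff)
    also have "\<dots> = - (\<Sum>k=1..n. psubst (on_fst D) (\<lambda>u. psubst (on_snd D) (?h k) (f u)) (m a (e k)))"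
    proof -
      have "act_lam_mu D \<beta> (psubst lam (\<lambda>x. shifted (f x)) q) = psubst (on_fst D) (\<lambda>u. psubst (on_snd D) (scaled_form \<beta>) (f u)) q" for \<beta> q
        unfolding act_lam_mu_shifted[symmetric]
        by (rule psubst_transfer[OF additive_lam additive_on_fst additive_act_lam_mu])
           (simp_all add: shifted_cdual_0 f act_lam_mu_lam)
      then show ?thesis
        by (simp add: dual_rep_at_shifted additive.minus[OF additive_act_lam_mu] sum_negf)
    qed
    finally show ?thesis .
  qed
  have "(\<Sum>j=1..n. psubst (on_fst D) (\<lambda>g. t (0, g)) (dual_rep m a (e' j)) y (e j, 0))
      = - (\<Sum>j=1..n. \<Sum>k=1..n. \<Sum>l\<le>degree (m a (e k)).
           t (0, e' k) ((D ^^ l) y) (s (e' j (coeff (m a (e k)) l)) (e j), 0))"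
    by (simp add: 1 dual_in_cdual sum_fun_apply psubst_on_fst form_scale sum_negf)
  also have "\<dots> = - (\<Sum>k=1..n. \<Sum>l\<le>degree (m a (e k)). \<Sum>j=1..n.
           t (0, e' k) ((D ^^ l) y) (s (e' j (coeff (m a (e k)) l)) (e j), 0))"
    by (subst sum.swap) (intro arg_cong[where f = uminus] sum.cong refl sum.swap)
  also have "\<dots> = - (\<Sum>k=1..n. \<Sum>l\<le>degree (m a (e k)).
           t (0, e' k) ((D ^^ l) y) (\<Sum>j=1..n. (s (e' j (coeff (m a (e k)) l)) (e j), 0)))"
    by (simp add: additive.sum[OF t.additive3])
  also have "\<dots> = - (\<Sum>k=1..n. \<Sum>l\<le>degree (m a (e k)). t (0, e' k) ((D ^^ l) y) (coeff (m a (e k)) l, 0))"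
    by (simp only: sum_pair_fst coordinates)
  finally show ?thesis by (simp add: psubst_on_fst)
qed

end

end


section \<open>Tensors modulo total derivatives\<close>

lemma additive_sum_keys:
  fixes f :: "'a \<Rightarrow> 'b::ab_group_add \<Rightarrow> 'c::ab_group_add"
  assumes f: "\<And>x. additive (f x)"
  shows "additive (\<lambda>r. \<Sum>x\<in>Poly_Mapping.keys r. f x (Poly_Mapping.lookup r x))"
proof -
  let ?F = "\<lambda>r. \<Sum>x\<in>Poly_Mapping.keys r. f x (Poly_Mapping.lookup r x)"
  have ext: "?F r = (\<Sum>x\<in>A. f x (Poly_Mapping.lookup r x))"
    if "finite A" "Poly_Mapping.keys r \<subseteq> A" for r A
    by (rule sum.mono_neutral_left[OF that]) (simp add: in_keys_iff additive.zero[OF f])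
  show ?thesis
  proof
    fix r r' :: "'a \<Rightarrow>\<^sub>0 'b"
    let ?A = "Poly_Mapping.keys r \<union> Poly_Mapping.keys r'"
    show "?F (r + r') = ?F r + ?F r'"
      using ext[of ?A "r + r'"] ext[of ?A r] ext[of ?A r'] keys_add[of r r']
      by (simp add: lookup_add additive.add[OF f] sum.distrib)
  qed
qed

lemma additive_lin_ext: "additive (lin_ext g)"
proof -
  have "lin_ext g = (\<lambda>r. \<Sum>x\<in>Poly_Mapping.keys r. fscale (Poly_Mapping.lookup r x) (g x))"
    by (simp add: lin_ext_def fun_eq_iff)
  moreover have "additive \<dots>"
    by (rule additive_sum_keys) (simp add: additive_def module.scale_left_distrib[OF module_fscale])
  ultimately show ?thesis by simp
qed

lemma keys_fscale: "Poly_Mapping.keys (fscale c x) \<subseteq> Poly_Mapping.keys x"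
  by (auto simp: in_keys_iff)

lemma lin_ext_fscale:
  fixes g :: "'a \<Rightarrow> 'b \<Rightarrow>\<^sub>0 'k::field"
  shows "lin_ext g (fscale c x) = fscale c (lin_ext g x)"
proof -
  interpret module "fscale :: 'k \<Rightarrow> ('b \<Rightarrow>\<^sub>0 'k) \<Rightarrow> _" by (rule module_fscale)
  have "lin_ext g (fscale c x) = (\<Sum>a\<in>Poly_Mapping.keys x. fscale (c * Poly_Mapping.lookup x a) (g a))"
    unfolding lin_ext_def lookup_fscale
    by (rule sum.mono_neutral_left) (use keys_fscale in \<open>auto simp: in_keys_iff\<close>)
  then show ?thesis
    by (simp add: lin_ext_def scale_sum_right)
qed

lemma fscale_1 [simp]: "fscale 1 x = x"
  by (rule module.scale_one[OF module_fscale])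

lemma lin_ext_tensor3: "lin_ext g (tensor3 a b c) = g (a, b, c)"
  by (simp add: lin_ext_def tensor3_def)

lemma pd_tensor3:
  "pd1 s (tensor3 a b c) = tensor3 (pd s a) b c"
  "pd2 s (tensor3 a b c) = tensor3 a (pd s b) c"
  "pd3 s (tensor3 a b c) = tensor3 a b (pd s c)"
  by (simp_all add: pd1_def pd2_def pd3_def lin_ext_tensor3)

lemma pd_funpow_tensor3:
  "(pd1 s ^^ k) (tensor3 a b c) = tensor3 ((pd s ^^ k) a) b c"
  "(pd2 s ^^ k) (tensor3 a b c) = tensor3 a ((pd s ^^ k) b) c"
  "(pd3 s ^^ k) (tensor3 a b c) = tensor3 a b ((pd s ^^ k) c)"
  by (induction k) (simp_all add: pd_tensor3)

text \<open>
  If \<open>x\<close> is outside the span, it extends a basis of the span to an independent set, and a functional that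
  is \<open>1\<close> at \<open>x\<close> and \<open>0\<close> on that basis separates \<open>x\<close> from \<open>W\<close>.
\<close>

lemma in_span_if_functionals_vanish:
  fixes scale :: "'k::field \<Rightarrow> 'v::ab_group_add \<Rightarrow> 'v"
  assumes "vector_space scale"
    and vanish: "\<And>\<phi>. additive \<phi> \<Longrightarrow> (\<And>c y. \<phi> (scale c y) = c * \<phi> y) \<Longrightarrow> (\<And>w. w \<in> W \<Longrightarrow> \<phi> w = 0) \<Longrightarrow> \<phi> x = 0"
  shows "x \<in> module.span scale W"
proof (rule ccontr)
  interpret vector_space scale by fact
  interpret field: vector_space "(*) :: 'k \<Rightarrow> 'k \<Rightarrow> 'k"
    by unfold_locales (simp_all add: algebra_simps)
  interpret P: vector_space_pair scale "(*) :: 'k \<Rightarrow> 'k \<Rightarrow> 'k" ..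
  assume x: "x \<notin> span W"
  obtain B where B: "B \<subseteq> W" "independent B" "W \<subseteq> span B"
    using maximal_independent_subset by blast
  have "span W = span B"
    using B span_mono[of B W] span_minimal[of W "span B"] subspace_span by blast
  with x have x: "x \<notin> span B" by simp
  then have "independent (insert x B)"
    using B(2) by (simp add: independent_insert)
  then obtain \<phi> where \<phi>: "Vector_Spaces.linear scale (*) \<phi>" "\<And>y. y \<in> insert x B \<Longrightarrow> \<phi> y = (if y = x then 1 else 0)"
    using P.linear_independent_extend[of "insert x B" "\<lambda>y. if y = x then 1 else 0"] by blast
  interpret lin: Vector_Spaces.linear scale "(*)" \<phi> by (rule \<phi>(1))
  have "\<phi> b = 0" if "b \<in> B" for b
    using \<phi>(2)[of b] that x span_base[of b B] by auto
  then have "\<phi> w = 0" if "w \<in> W" for w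
    using lin.eq_0_on_span[of B w] B(3) that by auto
  then have "\<phi> x = 0"
    by (rule vanish[rotated 2]) (simp_all add: additive_def lin.add lin.scale)
  then show False using \<phi>(2)[of x] by simp
qed

text \<open>
  The formal combinations that represent elements of \<open>\<partial>\<^sup>\<otimes>\<^sup>3(Q \<otimes> Q \<otimes> Q)\<close> are spanned by the
  multilinearity relations and the total derivatives of pure tensors, so membership can be tested by
  the functionals that vanish on both.
\<close>

lemma in_pd_imageI:
  fixes s :: "'k::field poly \<Rightarrow> 'q::ab_group_add \<Rightarrow> 'q"
  assumes vanish: "\<And>\<phi>. \<lbrakk>additive \<phi>; \<And>c y. \<phi> (fscale c y) = c * \<phi> y;
     \<And>c a a' x y. \<lbrakk>a \<in> Q; a' \<in> Q; x \<in> Q; y \<in> Q\<rbrakk> \<Longrightarrow>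
       \<phi> (tensor3 (kscale s c a + a') x y) = c * \<phi> (tensor3 a x y) + \<phi> (tensor3 a' x y);
     \<And>c a a' x y. \<lbrakk>a \<in> Q; a' \<in> Q; x \<in> Q; y \<in> Q\<rbrakk> \<Longrightarrow>
       \<phi> (tensor3 x (kscale s c a + a') y) = c * \<phi> (tensor3 x a y) + \<phi> (tensor3 x a' y);
     \<And>c a a' x y. \<lbrakk>a \<in> Q; a' \<in> Q; x \<in> Q; y \<in> Q\<rbrakk> \<Longrightarrow>
       \<phi> (tensor3 x y (kscale s c a + a')) = c * \<phi> (tensor3 x y a) + \<phi> (tensor3 x y a');
     \<And>x y z. \<lbrakk>x \<in> Q; y \<in> Q; z \<in> Q\<rbrakk> \<Longrightarrow>
       \<phi> (tensor3 (pd s x) y z) + \<phi> (tensor3 x (pd s y) z) + \<phi> (tensor3 x y (pd s z)) = 0\<rbrakk>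
     \<Longrightarrow> \<phi> X = 0"
  shows "in_pd_image s Q X"
proof -
  interpret module "fscale :: 'k \<Rightarrow> (('q \<times> 'q \<times> 'q) \<Rightarrow>\<^sub>0 'k) \<Rightarrow> _" by (rule module_fscale)
  define R where "R =
     ({tensor3 (kscale s x a + a') b c - fscale x (tensor3 a b c) - tensor3 a' b c | x a a' b c.
         a \<in> Q \<and> a' \<in> Q \<and> b \<in> Q \<and> c \<in> Q} \<union>
      {tensor3 a (kscale s x b + b') c - fscale x (tensor3 a b c) - tensor3 a b' c | x a b b' c.
         a \<in> Q \<and> b \<in> Q \<and> b' \<in> Q \<and> c \<in> Q} \<union>
      {tensor3 a b (kscale s x c + c') - fscale x (tensor3 a b c) - tensor3 a b c' | x a b c c'.
         a \<in> Q \<and> b \<in> Q \<and> c \<in> Q \<and> c' \<in> Q} :: (('q \<times> 'q \<times> 'q) \<Rightarrow>\<^sub>0 'k) set)"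
  define pds where "pds = (\<lambda>y. pd1 s y + pd2 s y + pd3 s y)"
  define U where "U = {pds (tensor3 x y z) | x y z. x \<in> Q \<and> y \<in> Q \<and> z \<in> Q}"
  have pds_add: "pds (y + z) = pds y + pds z" and pds_scale: "pds (fscale c y) = fscale c (pds y)" for y z c
    by (simp_all add: pds_def pd1_def pd2_def pd3_def additive.add[OF additive_lin_ext] lin_ext_fscale
        scale_right_distrib add_ac)
  have "X \<in> span (R \<union> U)"
  proof (rule in_span_if_functionals_vanish[OF vector_space_fscale])
    fix \<phi> :: "_ \<Rightarrow> 'k"
    assume \<phi>: "additive \<phi>" "\<And>c y. \<phi> (fscale c y) = c * \<phi> y" and 0: "\<And>w. w \<in> R \<union> U \<Longrightarrow> \<phi> w = 0"
    interpret \<phi>: additive \<phi> by fact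
    have U0: "\<phi> (pds (tensor3 x y z)) = 0" if "x \<in> Q" "y \<in> Q" "z \<in> Q" for x y z
      using that by (intro 0 UnI2) (unfold U_def, blast)
    show "\<phi> X = 0"
    proof (rule vanish[OF \<phi>], goal_cases)
      case (1 c a a' x y)
      then have "\<phi> (tensor3 (kscale s c a + a') x y - fscale c (tensor3 a x y) - tensor3 a' x y) = 0"
        by (intro 0 UnI1) (unfold R_def, blast)
      then show ?case by (simp only: \<phi>.diff \<phi>(2)) (simp add: algebra_simps)
    next
      case (2 c a a' x y)
      then have "\<phi> (tensor3 x (kscale s c a + a') y - fscale c (tensor3 x a y) - tensor3 x a' y) = 0"
        by (intro 0 UnI1) (unfold R_def, blast)
      then show ?case by (simp only: \<phi>.diff \<phi>(2)) (simp add: algebra_simps)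
    next
      case (3 c a a' x y)
      then have "\<phi> (tensor3 x y (kscale s c a + a') - fscale c (tensor3 x y a) - tensor3 x y a') = 0"
        by (intro 0 UnI1) (unfold R_def, blast)
      then show ?case by (simp only: \<phi>.diff \<phi>(2)) (simp add: algebra_simps)
    next
      case (4 x y z)
      then show ?case using U0[of x y z] by (simp add: pds_def pd_tensor3 \<phi>.add)
    qed
  qed
  then obtain r u where X: "X = r + u" "r \<in> span R" "u \<in> span U"
    by (auto simp: span_Un)
  have "\<exists>y. Poly_Mapping.keys y \<subseteq> Q \<times> Q \<times> Q \<and> u = pds y"
    using X(3)
  proof (induction rule: span_induct_alt)
    case base
    then show ?case by (intro exI[of _ 0]) (simp add: pds_def pd1_def pd2_def pd3_def lin_ext_def)
  next
    case (step c v w)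
    then obtain y x1 x2 x3 where *: "Poly_Mapping.keys y \<subseteq> Q \<times> Q \<times> Q" "w = pds y"
      "v = pds (tensor3 x1 x2 x3)" "x1 \<in> Q" "x2 \<in> Q" "x3 \<in> Q"
      unfolding U_def by blast
    have "Poly_Mapping.keys (fscale c (tensor3 x1 x2 x3) + y) \<subseteq> Q \<times> Q \<times> Q"
      using keys_add[of "fscale c (tensor3 x1 x2 x3)" y] keys_fscale[of c "tensor3 x1 x2 x3"] *
      by (simp add: tensor3_def) blast
    then show ?case using * by (intro exI[of _ "fscale c (tensor3 x1 x2 x3) + y"]) (simp add: pds_add pds_scale)
  qed
  then obtain y where "Poly_Mapping.keys y \<subseteq> Q \<times> Q \<times> Q" "u = pds y" by blast
  moreover have "X - u \<in> tensor3_rel s Q"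
    using X by (simp add: tensor3_rel_def R_def)
  ultimately show ?thesis
    unfolding in_pd_image_def pds_def by blast
qed

text \<open>
  \<open>double_sum\<close> runs over the support of \<open>r\<close>, while \<open>r\<close> is given as a sum over \<open>I\<close>; as \<open>double_sum\<close> is
  bilinear in the coefficients of \<open>r\<close>, it expands along that sum even if some of its terms coincide.
\<close>

lemma functional_double_sum:
  fixes \<phi> :: "('q \<times> 'q \<times> 'q \<Rightarrow>\<^sub>0 'k::field) \<Rightarrow> 'k"
  assumes "additive \<phi>" "\<And>c y. \<phi> (fscale c y) = c * \<phi> y"
    and r: "r = (\<Sum>i\<in>I. tensor2 (x i) (y i) - tensor2 (y i) (x i))"
  shows "\<phi> (double_sum g r) = (\<Sum>i\<in>I. \<Sum>j\<in>I.
     \<phi> (g (x i) (y i) (x j) (y j)) - \<phi> (g (x i) (y i) (y j) (x j))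
     - \<phi> (g (y i) (x i) (x j) (y j)) + \<phi> (g (y i) (x i) (y j) (x j)))"
proof -
  interpret \<phi>: additive \<phi> by fact
  define L where "L = (\<lambda>h. \<lambda>r :: 'q \<times> 'q \<Rightarrow>\<^sub>0 'k. \<Sum>z\<in>Poly_Mapping.keys r. h z * Poly_Mapping.lookup r z)"
  have L: "additive (L h)" for h
    unfolding L_def by (rule additive_sum_keys) (simp add: additive_def algebra_simps)
  have L_tensor2: "L h (tensor2 a b) = h (a, b)" for h a b
    by (simp add: L_def tensor2_def)
  have L_r: "L h r = (\<Sum>i\<in>I. h (x i, y i) - h (y i, x i))" for h
    by (simp add: r additive.sum[OF L] additive.diff[OF L] L_tensor2)
  have "\<phi> (double_sum g r) = L (\<lambda>z. L (\<lambda>w. \<phi> (g (fst z) (snd z) (fst w) (snd w))) r) r"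
    unfolding double_sum_def L_def \<phi>.sum assms(2) sum_distrib_right
    by (intro sum.cong refl) (simp only: mult_ac)
  also have "\<dots> = (\<Sum>i\<in>I. \<Sum>j\<in>I.
     \<phi> (g (x i) (y i) (x j) (y j)) - \<phi> (g (x i) (y i) (y j) (x j))
     - \<phi> (g (y i) (x i) (x j) (y j)) + \<phi> (g (y i) (x i) (y j) (x j)))"
    unfolding L_r fst_conv snd_conv sum_subtractf[symmetric]
    by (intro sum.cong refl) (simp only: diff_diff_eq2 diff_add_eq)
  finally show ?thesis .
qed

lemma keys_sum_tensor2:
  fixes x y :: "_ \<Rightarrow> 'q"
  assumes "\<And>i. i \<in> I \<Longrightarrow> x i \<in> Q" "\<And>i. i \<in> I \<Longrightarrow> y i \<in> Q"
  shows "Poly_Mapping.keys (\<Sum>i\<in>I. tensor2 (x i) (y i) - tensor2 (y i) (x i) :: _ \<Rightarrow>\<^sub>0 'k::field) \<subseteq> Q \<times> Q"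
  using assms
proof (induction I rule: infinite_finite_induct)
  case (insert i I)
  let ?w = "tensor2 (x i) (y i) - tensor2 (y i) (x i) :: _ \<Rightarrow>\<^sub>0 'k"
  let ?v = "\<Sum>i\<in>I. tensor2 (x i) (y i) - tensor2 (y i) (x i) :: _ \<Rightarrow>\<^sub>0 'k"
  have "Poly_Mapping.keys ?w \<subseteq> Poly_Mapping.keys (tensor2 (x i) (y i) :: _ \<Rightarrow>\<^sub>0 'k)
      \<union> Poly_Mapping.keys (tensor2 (y i) (x i) :: _ \<Rightarrow>\<^sub>0 'k)"
    by (rule keys_diff)
  also have "\<dots> \<subseteq> Q \<times> Q"
    using insert.prems by (simp add: tensor2_def)
  finally have "Poly_Mapping.keys ?w \<union> Poly_Mapping.keys ?v \<subseteq> Q \<times> Q"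
    using insert.IH insert.prems by simp
  with keys_add have "Poly_Mapping.keys (?w + ?v) \<subseteq> Q \<times> Q"
    by (rule subset_trans)
  then show ?case
    using insert.hyps by simp
qed auto


section \<open>Invariant forms from functionals on tensors\<close>

lemma psubst_neg:
  assumes "additive T" "additive h"
  shows "psubst T h (- q) = - psubst T h q"
  by (rule additive.minus[OF additive_psubst[OF assms]])

lemma psubst_diff:
  assumes "additive T" "additive h"
  shows "psubst T h (p - q) = psubst T h p - psubst T h q"
  by (rule additive.diff[OF additive_psubst[OF assms]])

lemma skew_closed:
  assumes pd: "additive (pd s)" and V: "0 \<in> V" "\<And>x y. x \<in> V \<Longrightarrow> y \<in> V \<Longrightarrow> x + y \<in> V" "\<And>x. x \<in> V \<Longrightarrow> - x \<in> V"
    "\<And>x. x \<in> V \<Longrightarrow> pd s x \<in> V" and q: "\<And>k. coeff q k \<in> V"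
  shows "coeff (skew s q) k \<in> V"
  using q
proof (induction q arbitrary: k rule: pCons_induct)
  case 0
  then show ?case using V(1) by (simp add: skew_def)
next
  case (pCons a q)
  have q: "coeff q j \<in> V" for j
    using pCons.prems[of "Suc j"] by simp
  have a: "a \<in> V" using pCons.prems[of 0] by simp
  have "skew s (pCons a q) = [:a:] + (- pCons 0 (skew s q) - map_poly (pd s) (skew s q))"
    unfolding skew_def by (subst psubst_pCons[OF additive_skew_step[OF pd]]) simp_all
  then have "coeff (skew s (pCons a q)) k
      = coeff [:a:] k + (- coeff (pCons 0 (skew s q)) k + - pd s (coeff (skew s q) k))"
    by (simp only: coeff_add coeff_diff coeff_minus coeff_map_poly additive.zero[OF pd] diff_conv_add_uminus)
  also have "\<dots> \<in> V"
    using V(1) a pCons.IH[OF q] by (intro V(2,3,4)) (auto simp: coeff_pCons split: nat.split)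
  finally show ?case .
qed

lemma cdual_closed:
  "0 \<in> cdual s"
  "f \<in> cdual s \<Longrightarrow> g \<in> cdual s \<Longrightarrow> f + g \<in> cdual s"
  "f \<in> cdual s \<Longrightarrow> - f \<in> cdual s"
  "f \<in> cdual s \<Longrightarrow> g \<in> cdual s \<Longrightarrow> f - g \<in> cdual s"
  "f \<in> cdual s \<Longrightarrow> (\<lambda>u. p * f u) \<in> cdual s"
  "f \<in> cdual s \<Longrightarrow> pd (Chom_scale triv_scale) f \<in> cdual s"
  by (auto simp: cdual_iff algebra_simps smult_add_right smult_diff_right)

lemma additive_pd_Chom_scale: "additive (pd (Chom_scale triv_scale))"
  by (auto simp: additive_def fun_eq_iff)

text \<open>
  The form \<open>t\<close> agrees with \<open>\<phi>\<close> on the submodule \<open>Q\<close>, but is required to be invariant and trilinear on the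
  whole type; this removes all membership conditions from the computations with \<open>t\<close>.
\<close>

locale tensor_functional =
  fixes S :: "'k::field poly \<Rightarrow> 'q::ab_group_add \<Rightarrow> 'q" and Q :: "'q set"
    and \<phi> :: "('q \<times> 'q \<times> 'q \<Rightarrow>\<^sub>0 'k) \<Rightarrow> 'k" and t :: "'q \<Rightarrow> 'q \<Rightarrow> 'q \<Rightarrow> 'k"
  assumes additive_\<phi>: "additive \<phi>"
    and \<phi>_tensor3: "x \<in> Q \<Longrightarrow> y \<in> Q \<Longrightarrow> z \<in> Q \<Longrightarrow> \<phi> (tensor3 x y z) = t x y z"
    and form: "invariant_form S t"
    and pd_closed: "x \<in> Q \<Longrightarrow> pd S x \<in> Q"
begin

interpretation form: invariant_form S t by (rule form)
interpretation \<phi>: additive \<phi> by (rule additive_\<phi>)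

lemma pd_funpow_closed: "x \<in> Q \<Longrightarrow> (pd S ^^ k) x \<in> Q"
  by (induction k) (simp_all add: pd_closed)

context
  fixes q :: "'q poly" and x y :: 'q
  assumes q: "\<And>k. coeff q k \<in> Q" and x: "x \<in> Q" and y: "y \<in> Q"
begin

lemma insert_1_shift_2:
  "\<phi> (psubst (pd2 S) (\<lambda>z. tensor3 z x y) q) = psubst (on_fst (pd S)) t q x y"
  by (simp add: psubst_on_fst psubst_def[of "pd2 S"] \<phi>.sum pd_funpow_tensor3 \<phi>_tensor3 q x y pd_funpow_closed)

lemma insert_2_shift_3:
  "\<phi> (psubst (pd3 S) (\<lambda>z. tensor3 x z y) q) = psubst (on_fst (pd S)) (\<lambda>a b c. t c a b) q y x"
  by (simp add: psubst_on_fst psubst_def[of "pd3 S"] \<phi>.sum pd_funpow_tensor3 \<phi>_tensor3 q x y pd_funpow_closed)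

lemma insert_3_shift_2:
  "\<phi> (psubst (pd2 S) (\<lambda>z. tensor3 x y z) q) = psubst (on_fst (pd S)) (\<lambda>a b c. t c b a) q y x"
  by (simp add: psubst_on_fst psubst_def[of "pd2 S"] \<phi>.sum pd_funpow_tensor3 \<phi>_tensor3 q x y pd_funpow_closed)

lemma insert_3_shift_1:
  "\<phi> (psubst (pd1 S) (\<lambda>z. tensor3 x y z) q) = psubst (on_fst (pd S)) (\<lambda>a b c. t b c a) q x y"
  by (simp add: psubst_on_fst psubst_def[of "pd1 S"] \<phi>.sum pd_funpow_tensor3 \<phi>_tensor3 q x y pd_funpow_closed)

text \<open>
  The operator \<open>-\<partial>\<^sup>\<otimes>\<^sup>2 \<otimes> I\<close> agrees with \<open>I \<otimes> I \<otimes> \<partial>\<close> modulo total derivatives.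
\<close>

lemma insert_2_shift_neg_12:
  "\<phi> (psubst (\<lambda>y. - (pd1 S y + pd2 S y)) (\<lambda>z. tensor3 x z y) q)
    = psubst (on_fst (pd S)) (\<lambda>a b c. t c a b) q y x"
proof -
  let ?A = "\<lambda>y. - (pd1 S y + pd2 S y)"
  have add: "additive ?A"
    by (simp add: additive_def pd1_def pd2_def additive.add[OF additive_lin_ext])
  have "\<phi> ((?A ^^ k) (tensor3 x z y)) = t x z ((pd S ^^ k) y)" if "x \<in> Q" "z \<in> Q" for k x z
    using that
  proof (induction k arbitrary: x z)
    case 0
    then show ?case using y by (simp add: \<phi>_tensor3)
  next
    case (Suc k)
    have "(?A ^^ Suc k) (tensor3 x z y) = (?A ^^ k) (- tensor3 (pd S x) z y - tensor3 x (pd S z) y)"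
      by (simp add: funpow_Suc_right pd_tensor3 del: funpow.simps)
    also have "\<dots> = - (?A ^^ k) (tensor3 (pd S x) z y) - (?A ^^ k) (tensor3 x (pd S z) y)"
      by (simp only: additive.diff[OF additive_funpow[OF add]] additive.minus[OF additive_funpow[OF add]])
    finally have "\<phi> ((?A ^^ Suc k) (tensor3 x z y))
        = - t (pd S x) z ((pd S ^^ k) y) - t x (pd S z) ((pd S ^^ k) y)"
      using Suc by (simp add: \<phi>.diff \<phi>.minus pd_closed)
    also have "\<dots> = t x z (pd S ((pd S ^^ k) y))"
    proof -
      have "t x z (pd S ((pd S ^^ k) y)) = - (t (pd S x) z ((pd S ^^ k) y) + t x (pd S z) ((pd S ^^ k) y))"
        using form.inv[of x z "(pd S ^^ k) y"] by (simp only: eq_neg_iff_add_eq_0 add.commute)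
      then show ?thesis by simp
    qed
    finally show ?case by simp
  qed
  then show ?thesis
    by (simp only: psubst_on_fst psubst_def[of ?A] \<phi>.sum q x)
qed

end

end

context based_conformal_product
begin

abbreviation Q where "Q \<equiv> UNIV \<times> cdual s"

text \<open>
  A projection onto \<open>Q\<close>: it replaces a function by the conformal linear map with the same values on
  the basis.  It is linear and commutes with \<open>\<partial>\<close>, so composing with it extends an invariant form from
  \<open>Q\<close> to the whole type.
\<close>

definition proj :: "'v \<times> ('v \<Rightarrow> 'k poly) \<Rightarrow> 'v \<times> ('v \<Rightarrow> 'k poly)" where
  "proj x = (fst x, \<lambda>u. \<Sum>k=1..n. snd x (e k) * e' k u)"

lemma proj_in_Q: "proj x \<in> Q"
proof -
  have "(\<lambda>u. \<Sum>k\<in>K. p k * e' k u) \<in> cdual s" if "K \<subseteq> {1..n}" for K p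
  proof -
    have "finite K" using that finite_subset by blast
    then show ?thesis using that
    proof (induction K)
      case empty
      then show ?case using cdual_closed(1) by (simp add: zero_fun_def)
    next
      case (insert k K)
      then show ?case
        using cdual_closed(2)[OF cdual_closed(5)[OF dual_in_cdual[of k], of "p k"], of "\<lambda>u. \<Sum>k\<in>K. p k * e' k u"]
        by (simp add: plus_fun_def)
    qed
  qed
  then show ?thesis by (simp add: proj_def)
qed

lemma proj_id: "x \<in> Q \<Longrightarrow> proj x = x"
  by (cases x) (simp add: proj_def cdual_expansion del: One_nat_def)

lemma proj_add: "proj (x + y) = proj x + proj y"
  by (simp add: proj_def fun_eq_iff sum.distrib algebra_simps)

lemma proj_kscale: "proj (kscale S c x) = kscale S c (proj x)"
proof -
  have "additive (smult c)"
    by (simp add: additive_def smult_add_right)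
  then show ?thesis
    by (simp add: proj_def kscale_sd_scale fun_eq_iff additive.sum)
qed

lemma proj_pd: "proj (D x) = D (proj x)"
proof -
  have "additive (pCons (0::'k))"
    by (simp add: additive_def)
  then show ?thesis
    by (simp add: proj_def pd_sd_scale fun_eq_iff additive.sum flip: sum_negf)
qed

lemma kscale_1: "kscale S 1 x = x"
  by (cases x) (simp add: kscale_sd_scale, simp add: kscale_def flip: one_pCons)

text \<open>
  A functional as in \<open>in_pd_imageI\<close> is multilinear and invariant only on tensors with entries in \<open>Q\<close>;
  precomposing each argument with \<open>proj\<close> gives a form without this restriction.
\<close>

lemma in_pd_imageI_invariant_form:
  assumes "\<And>\<phi> t. \<lbrakk>tensor_functional S Q \<phi> t; \<And>c y. \<phi> (fscale c y) = c * \<phi> y\<rbrakk> \<Longrightarrow> \<phi> X = 0"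
  shows "in_pd_image S Q X"
proof (rule in_pd_imageI)
  fix \<phi> :: "_ \<Rightarrow> 'k"
  assume \<phi>: "additive \<phi>" "\<And>c y. \<phi> (fscale c y) = c * \<phi> y"
    and lin1: "\<And>c a a' x y. \<lbrakk>a \<in> Q; a' \<in> Q; x \<in> Q; y \<in> Q\<rbrakk> \<Longrightarrow>
       \<phi> (tensor3 (kscale S c a + a') x y) = c * \<phi> (tensor3 a x y) + \<phi> (tensor3 a' x y)"
    and lin2: "\<And>c a a' x y. \<lbrakk>a \<in> Q; a' \<in> Q; x \<in> Q; y \<in> Q\<rbrakk> \<Longrightarrow>
       \<phi> (tensor3 x (kscale S c a + a') y) = c * \<phi> (tensor3 x a y) + \<phi> (tensor3 x a' y)"
    and lin3: "\<And>c a a' x y. \<lbrakk>a \<in> Q; a' \<in> Q; x \<in> Q; y \<in> Q\<rbrakk> \<Longrightarrow>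
       \<phi> (tensor3 x y (kscale S c a + a')) = c * \<phi> (tensor3 x y a) + \<phi> (tensor3 x y a')"
    and inv: "\<And>x y z. \<lbrakk>x \<in> Q; y \<in> Q; z \<in> Q\<rbrakk> \<Longrightarrow>
       \<phi> (tensor3 (D x) y z) + \<phi> (tensor3 x (D y) z) + \<phi> (tensor3 x y (D z)) = 0"
  define t where "t = (\<lambda>x y z. \<phi> (tensor3 (proj x) (proj y) (proj z)))"
  have Q0: "0 \<in> Q" using cdual_closed(1) by (simp add: zero_prod_def)
  have k0: "kscale S c 0 = 0" for c
    by (simp add: kscale_sd_scale zero_prod_def fun_eq_iff additive.zero[OF additive_kscale])
  have zero: "\<phi> (tensor3 0 x y) = 0" "\<phi> (tensor3 x 0 y) = 0" "\<phi> (tensor3 x y 0) = 0" if "x \<in> Q" "y \<in> Q" for x y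
    using lin1[OF Q0 Q0 that, of 1] lin2[OF Q0 Q0 that, of 1] lin3[OF Q0 Q0 that, of 1] by (simp_all add: k0)
  have "invariant_form S t"
  proof (unfold_locales, goal_cases)
    case (1 x x' y z)
    then show ?case using lin1[of "proj x" "proj x'" "proj y" "proj z" 1] proj_in_Q
      by (simp add: t_def proj_add kscale_1)
  next
    case (2 x y y' z)
    then show ?case using lin2[of "proj y" "proj y'" "proj x" "proj z" 1] proj_in_Q
      by (simp add: t_def proj_add kscale_1)
  next
    case (3 x y z z')
    then show ?case using lin3[of "proj z" "proj z'" "proj x" "proj y" 1] proj_in_Q
      by (simp add: t_def proj_add kscale_1)
  next
    case (4 c x y z)
    then show ?case using lin1[OF proj_in_Q[of x] Q0 proj_in_Q[of y] proj_in_Q[of z], of c] zero[OF proj_in_Q proj_in_Q]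
      by (simp add: t_def proj_kscale)
  next
    case (5 x c y z)
    then show ?case using lin2[OF proj_in_Q[of y] Q0 proj_in_Q[of x] proj_in_Q[of z], of c] zero[OF proj_in_Q proj_in_Q]
      by (simp add: t_def proj_kscale)
  next
    case (6 x y c z)
    then show ?case using lin3[OF proj_in_Q[of z] Q0 proj_in_Q[of x] proj_in_Q[of y], of c] zero[OF proj_in_Q proj_in_Q]
      by (simp add: t_def proj_kscale)
  next
    case (7 x y z)
    show ?case using inv[OF proj_in_Q[of x] proj_in_Q[of y] proj_in_Q[of z]] by (simp add: t_def proj_pd)
  qed
  then have "tensor_functional S Q \<phi> t"
    using \<phi>(1) cdual_closed(6)
    by (intro tensor_functional.intro) (auto simp: t_def proj_id pd_sd_scale simp del: pd_Chom_scale)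
  then show "\<phi> X = 0" using \<phi>(2) by (rule assms)
qed

end


section \<open>The Yang-Baxter equation\<close>

lemma (in invariant_form) psubst_embed_skew:
  fixes \<iota> :: "'v::ab_group_add \<Rightarrow> 'q"
  assumes \<iota>: "additive \<iota>" and pd: "additive (pd s)" and comm: "\<And>x. \<iota> (pd s x) = pd S (\<iota> x)"
  shows "psubst (on_fst (pd S)) (\<lambda>v. t (\<iota> v)) (skew s q) y z
      = psubst (on_fst (pd S)) (\<lambda>v y z. t (\<iota> v) z y) q z y"
proof -
  have "psubst (on_fst (pd S)) (\<lambda>v. t (\<iota> v)) (skew s q) = psubst (on_snd (pd S)) (\<lambda>v. t (\<iota> v)) q"
  proof (rule psubst_skew[OF _ pd])
    show "additive (\<lambda>v. t (\<iota> v))"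
      by (simp add: additive_def additive.add[OF \<iota>] additive.add[OF additive1])
  qed (simp add: comm inv)
  then show ?thesis by (simp add: psubst_on_snd)
qed

lemma psubst_on_fst_0:
  "(\<And>b c. h 0 b c = 0) \<Longrightarrow> psubst (on_fst D) h 0 b c = 0" for h :: "_ \<Rightarrow> _ \<Rightarrow> _ \<Rightarrow> 'k::ab_group_add"
  by (simp add: psubst_on_fst)

context based_conformal_product
begin

abbreviation dual_module :: "'k poly \<Rightarrow> ('v \<Rightarrow> 'k poly) \<Rightarrow> 'v \<Rightarrow> 'k poly" where
  "dual_module \<equiv> Chom_scale triv_scale"

abbreviation bracket where
  "bracket \<equiv> sd_bracket dual_module (assoc_bracket s m) (dual_rep m)"

abbreviation product where
  "product \<equiv> sd_product dual_module (assoc_product s m) (\<lambda>a f. - dual_rep m a f)"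

lemma coeff_dual_rep_cdual: "f \<in> cdual s \<Longrightarrow> coeff (dual_rep m a f) k \<in> cdual s"
  by (simp add: coeff_dual_rep dual_rep_coeff_cdual)

lemma coeff_skew_cdual: "(\<And>k. coeff q k \<in> cdual s) \<Longrightarrow> coeff (skew dual_module q) k \<in> cdual s"
  by (rule skew_closed[OF additive_pd_Chom_scale]) (simp_all add: cdual_closed del: pd_Chom_scale)

lemma coeff_bracket_in: "x \<in> Q \<Longrightarrow> y \<in> Q \<Longrightarrow> coeff (bracket x y) k \<in> Q"
  by (simp add: sd_bracket_def coeff_map_poly zero_prod_def mem_Times_iff cdual_closed coeff_dual_rep_cdual coeff_skew_cdual)

lemma coeff_product_in: "x \<in> Q \<Longrightarrow> y \<in> Q \<Longrightarrow> coeff (product x y) k \<in> Q"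
  by (simp add: sd_product_def coeff_map_poly zero_prod_def mem_Times_iff cdual_closed coeff_dual_rep_cdual coeff_skew_cdual)

lemma dual_rep_0_left: "f \<in> cdual s \<Longrightarrow> dual_rep m 0 f = 0"
  by (intro poly_eqI ext)
     (simp add: coeff_dual_rep dual_rep_coeff_def dual_rep_at_shifted additive.zero[OF additive_left] shifted_cdual_0)

lemma dual_rep_0_right: "dual_rep m a (0 :: 'v \<Rightarrow> 'k poly) = 0"
proof -
  have "psubst lam (\<lambda>x. 0) q = (0 :: 'k poly poly)" for q :: "'v poly"
    by (induction q) (simp_all add: psubst_pCons additive_lam)
  then have "dual_rep_coeff m a (0 :: 'v \<Rightarrow> 'k poly) l = 0" for l
    by (intro ext) (simp add: dual_rep_coeff_def dual_rep_at_shifted additive.zero[OF additive_shifted])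
  then show ?thesis
    by (intro poly_eqI) (simp only: coeff_dual_rep[OF cdual_closed(1)] coeff_0)
qed

context
  fixes t :: "'v \<times> ('v \<Rightarrow> 'k poly) \<Rightarrow> 'v \<times> ('v \<Rightarrow> 'k poly) \<Rightarrow> 'v \<times> ('v \<Rightarrow> 'k poly) \<Rightarrow> 'k"
  assumes t: "invariant_form S t"
begin

interpretation t: invariant_form S t by (rule t)

lemma additive_embed: "additive (\<lambda>a. t (a, 0))" "additive (\<lambda>f. t (0, f))"
proof -
  have "(a + b, 0 :: 'v \<Rightarrow> 'k poly) = (a, 0) + (b, 0)" for a b :: 'v by simp
  moreover have "(0 :: 'v, f + g) = (0, f) + (0, g)" for f g :: "'v \<Rightarrow> 'k poly" by simp
  ultimately show "additive (\<lambda>a. t (a, 0))" "additive (\<lambda>f. t (0, f))"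
    by (simp_all only: additive_def additive.add[OF t.additive1] simp_thms)
qed

lemma form_skew:
  "psubst (on_fst D) (\<lambda>v. t (v, 0)) (skew s q) y z = psubst (on_fst D) (\<lambda>v y z. t (v, 0) z y) q z y"
  "psubst (on_fst D) (\<lambda>v. t (0, v)) (skew dual_module d) y z = psubst (on_fst D) (\<lambda>v y z. t (0, v) z y) d z y"
proof -
  show "psubst (on_fst D) (\<lambda>v. t (v, 0)) (skew s q) y z = psubst (on_fst D) (\<lambda>v y z. t (v, 0) z y) q z y"
    by (rule t.psubst_embed_skew[OF _ additive_pd])
       (simp_all add: additive_def pd_sd_scale zero_fun_def)
  show "psubst (on_fst D) (\<lambda>v. t (0, v)) (skew dual_module d) y z = psubst (on_fst D) (\<lambda>v y z. t (0, v) z y) d z y"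
    by (rule t.psubst_embed_skew[OF _ additive_pd_Chom_scale])
       (simp_all add: additive_def pd_sd_scale additive.zero[OF additive_pd])
qed

lemma form_embed:
  "psubst (on_fst D) t (map_poly (\<lambda>a. (a, 0)) q + map_poly (\<lambda>v. (0, v)) d)
    = psubst (on_fst D) (\<lambda>a. t (a, 0)) q + psubst (on_fst D) (\<lambda>v. t (0, v)) d"
  using additive.zero[OF t.additive1]
  by (simp add: psubst_add t.additive1 psubst_map_poly zero_prod_def)

text \<open>
  The bracket inserted into an invariant form: the two skewed terms shift the derivation to the third
  argument, which appears as an exchange of the last two arguments.
\<close>

lemma form_bracket:
  "psubst (on_fst D) t (bracket x x') y z
   = psubst (on_fst D) (\<lambda>a. t (a, 0)) (m (fst x) (fst x')) y z
   - psubst (on_fst D) (\<lambda>a y z. t (a, 0) z y) (m (fst x') (fst x)) z y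
   + psubst (on_fst D) (\<lambda>v. t (0, v)) (dual_rep m (fst x) (snd x')) y z
   - psubst (on_fst D) (\<lambda>v y z. t (0, v) z y) (dual_rep m (fst x') (snd x)) z y"
  by (simp add: sd_bracket_def form_embed assoc_bracket_def psubst_diff additive_embed form_skew)

lemma form_product:
  "psubst (on_fst D) t (product x x') y z
   = psubst (on_fst D) (\<lambda>a. t (a, 0)) (m (fst x) (fst x')) y z
   + psubst (on_fst D) (\<lambda>a y z. t (a, 0) z y) (m (fst x') (fst x)) z y
   - psubst (on_fst D) (\<lambda>v. t (0, v)) (dual_rep m (fst x) (snd x')) y z
   - psubst (on_fst D) (\<lambda>v y z. t (0, v) z y) (dual_rep m (fst x') (snd x)) z y"
proof -
  have "additive (\<lambda>v y z. t (0, v) z y)"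
    using additive_embed(2) by (simp add: additive_def fun_eq_iff)
  then show ?thesis
    by (simp add: sd_product_def form_embed assoc_product_def psubst_add psubst_diff psubst_neg
        additive_embed form_skew)
qed

end

text \<open>
  The two kinds of summands to which all terms of the Yang-Baxter expressions reduce.
\<close>

definition mult_term where
  "mult_term t i j = psubst (on_fst D) (\<lambda>a. t (a, 0)) (m (e i) (e j)) (0, e' i) (0, e' j)"

definition dual_term where
  "dual_term t i j = psubst (on_fst D) (\<lambda>v. t (0, v)) (dual_rep m (e i) (e' j)) (0, e' i) (e j, 0)"

lemma sum_dual_term:
  assumes "invariant_form S t"
  shows "(\<Sum>i=1..n. \<Sum>j=1..n. dual_term t i j) = - (\<Sum>i=1..n. \<Sum>j=1..n. mult_term (\<lambda>x y z. t z y x) i j)"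
  unfolding dual_term_def mult_term_def adjoint[OF assms] sum_negf ..

context
  fixes t assumes t: "invariant_form S t"
begin

text \<open>
  The insertions that occur when \<open>r\<close> is substituted: the argument carrying the derivation and the
  remaining one are the partners of the two inserted elements in \<open>r\<close>.
\<close>

lemma form_bracket_basis:
  assumes i: "i \<in> {1..n}" and j: "j \<in> {1..n}"
  shows "psubst (on_fst D) t (bracket (e i, 0) (e j, 0)) (0, e' i) (0, e' j)
       = mult_term t i j - mult_term (\<lambda>x y z. t x z y) j i"
    and "psubst (on_fst D) t (bracket (e j, 0) (e i, 0)) (0, e' j) (0, e' i)
       = mult_term t j i - mult_term (\<lambda>x y z. t x z y) i j"
    and "psubst (on_fst D) t (bracket (e i, 0) (0, e' j)) (0, e' i) (e j, 0) = dual_term t i j"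
    and "psubst (on_fst D) t (bracket (e j, 0) (0, e' i)) (0, e' j) (e i, 0) = dual_term t j i"
    and "psubst (on_fst D) t (bracket (0, e' i) (e j, 0)) (e i, 0) (0, e' j)
       = - dual_term (\<lambda>x y z. t x z y) j i"
    and "psubst (on_fst D) t (bracket (0, e' j) (e i, 0)) (e j, 0) (0, e' i)
       = - dual_term (\<lambda>x y z. t x z y) i j"
    and "psubst (on_fst D) t (bracket (0, e' i) (0, e' j)) y z = 0"
    and "psubst (on_fst D) t (bracket (0, e' j) (0, e' i)) y z = 0"
  using dual_in_cdual[OF i] dual_in_cdual[OF j] additive.zero[OF additive_embed(1)[OF t]] additive.zero[OF additive_embed(2)[OF t]]
  by (simp_all add: form_bracket[OF t] psubst_on_fst_0 mult_term_def dual_term_def dual_rep_0_left dual_rep_0_right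
      additive.zero[OF additive_left] additive.zero[OF additive_right])

lemma form_product_basis:
  assumes i: "i \<in> {1..n}" and j: "j \<in> {1..n}"
  shows "psubst (on_fst D) t (product (e i, 0) (e j, 0)) (0, e' i) (0, e' j)
       = mult_term t i j + mult_term (\<lambda>x y z. t x z y) j i"
    and "psubst (on_fst D) t (product (e j, 0) (e i, 0)) (0, e' j) (0, e' i)
       = mult_term t j i + mult_term (\<lambda>x y z. t x z y) i j"
    and "psubst (on_fst D) t (product (e i, 0) (0, e' j)) (0, e' i) (e j, 0) = - dual_term t i j"
    and "psubst (on_fst D) t (product (e j, 0) (0, e' i)) (0, e' j) (e i, 0) = - dual_term t j i"
    and "psubst (on_fst D) t (product (0, e' i) (e j, 0)) (e i, 0) (0, e' j)
       = - dual_term (\<lambda>x y z. t x z y) j i"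
    and "psubst (on_fst D) t (product (0, e' j) (e i, 0)) (e j, 0) (0, e' i)
       = - dual_term (\<lambda>x y z. t x z y) i j"
    and "psubst (on_fst D) t (product (0, e' i) (0, e' j)) y z = 0"
    and "psubst (on_fst D) t (product (0, e' j) (0, e' i)) y z = 0"
  using dual_in_cdual[OF i] dual_in_cdual[OF j] additive.zero[OF additive_embed(1)[OF t]] additive.zero[OF additive_embed(2)[OF t]]
  by (simp_all add: form_product[OF t] psubst_on_fst_0 mult_term_def dual_term_def dual_rep_0_left dual_rep_0_right
      additive.zero[OF additive_left] additive.zero[OF additive_right])

end

abbreviation canonical where
  "canonical \<equiv> \<Sum>i = 1..n. tensor2 (e i, 0) (0, e' i) - tensor2 (0, e' i) (e i, 0)"

lemma basis_in_Q: "(a, 0) \<in> Q" "i \<in> {1..n} \<Longrightarrow> (0, e' i) \<in> Q"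
  using cdual_closed(1) dual_in_cdual by auto

text \<open>
  After \<open>sum_dual_term\<close> and exchanging \<open>i\<close> and \<open>j\<close> where necessary, every double sum is
  \<open>\<plusminus> \<Sum>i j. mult_term \<tau> i j\<close> with \<open>\<tau>\<close> a permutation of \<open>t\<close>, and equal ones occur with opposite signs.
\<close>

lemma cyb_canonical: "in_pd_image S Q (cyb S bracket canonical)"
proof (rule in_pd_imageI_invariant_form)
  fix \<phi> t assume "tensor_functional S Q \<phi> t" and \<phi>: "\<And>c y. \<phi> (fscale c y) = c * \<phi> y"
  then interpret tensor_functional S Q \<phi> t by simp
  interpret \<phi>: additive \<phi> by (rule additive_\<phi>)
  let ?t23 = "\<lambda>x y z. t x z y" and ?t12 = "\<lambda>x y z. t y x z" and ?t312 = "\<lambda>x y z. t z x y"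
    and ?t13 = "\<lambda>x y z. t z y x" and ?t231 = "\<lambda>x y z. t y z x"
  note inv = invariant_form_permuted[OF form]
  let ?g = "\<lambda>ri li rj lj. \<phi> (
       psubst (pd2 S) (\<lambda>z. tensor3 z li lj) (bracket ri rj)
     - psubst (pd3 S) (\<lambda>z. tensor3 ri z lj) (bracket rj li)
     - psubst (pd2 S) (\<lambda>z. tensor3 ri rj z) (bracket lj li))"
  have "\<phi> (cyb S bracket canonical) = (\<Sum>i=1..n. \<Sum>j=1..n.
      ?g (e i, 0) (0, e' i) (e j, 0) (0, e' j) - ?g (e i, 0) (0, e' i) (0, e' j) (e j, 0)
      - ?g (0, e' i) (e i, 0) (e j, 0) (0, e' j) + ?g (0, e' i) (e i, 0) (0, e' j) (e j, 0))"
    unfolding cyb_def by (rule functional_double_sum[OF additive_\<phi> \<phi> refl])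
  \<comment> \<open>One line for each of the four summands above.  Of the three insertions in a summand, those of the
     product of two elements of \<open>P\<^sup>*\<close> vanish.\<close>
  also have "\<dots> = (\<Sum>i=1..n. \<Sum>j=1..n.
      (mult_term t i j - mult_term ?t23 j i - dual_term ?t312 j i)
      - (dual_term t i j - dual_term ?t13 j i)
      - (- dual_term ?t23 j i - mult_term ?t312 j i + mult_term ?t12 i j + dual_term ?t231 i j)
      + (dual_term ?t12 i j - mult_term ?t13 j i + mult_term ?t231 i j))"
  proof (intro sum.cong refl, goal_cases)
    case (1 i j)
    note [simp] = form_bracket_basis[OF form 1] form_bracket_basis[OF inv(3) 1] form_bracket_basis[OF inv(4) 1]
    have G: "?g ri li rj lj = psubst (on_fst D) t (bracket ri rj) li lj
       - psubst (on_fst D) ?t312 (bracket rj li) lj ri - psubst (on_fst D) ?t13 (bracket lj li) rj ri"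
      if "ri \<in> Q" "li \<in> Q" "rj \<in> Q" "lj \<in> Q" for ri li rj lj
      using that by (simp only: \<phi>.diff insert_1_shift_2 insert_2_shift_3 insert_3_shift_2 coeff_bracket_in)
    note Q = basis_in_Q(1)[of "e i"] basis_in_Q(1)[of "e j"] basis_in_Q(2)[OF 1(1)] basis_in_Q(2)[OF 1(2)]
    show ?case
      unfolding G[OF Q(1,3,2,4)] G[OF Q(1,3,4,2)] G[OF Q(3,1,2,4)] G[OF Q(3,1,4,2)] by simp
  qed
  also have "\<dots> = 0"
  proof -
    have sw: "(\<Sum>i=1..n. \<Sum>j=1..n. X j i) = (\<Sum>i=1..n. \<Sum>j=1..n. X i j)" for X :: "nat \<Rightarrow> nat \<Rightarrow> 'k"
      by (rule sum.swap)
    show ?thesis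
      by (simp only: sum.distrib sum_subtractf sum_negf sw[of "mult_term _"] sw[of "dual_term _"]
          sum_dual_term[OF form] sum_dual_term[OF inv(1)] sum_dual_term[OF inv(2)] sum_dual_term[OF inv(3)]
          sum_dual_term[OF inv(4)] sum_dual_term[OF inv(5)]) simp
  qed
  finally show "\<phi> (cyb S bracket canonical) = 0" .
qed

text \<open>
  The same cancellation; the symmetric product and the sign of the dual representation replace the
  antisymmetric bracket.
\<close>

lemma ayb_canonical: "in_pd_image S Q (ayb S product canonical)"
proof (rule in_pd_imageI_invariant_form)
  fix \<phi> t assume "tensor_functional S Q \<phi> t" and \<phi>: "\<And>c y. \<phi> (fscale c y) = c * \<phi> y"
  then interpret tensor_functional S Q \<phi> t by simp
  interpret \<phi>: additive \<phi> by (rule additive_\<phi>)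
  let ?t23 = "\<lambda>x y z. t x z y" and ?t12 = "\<lambda>x y z. t y x z" and ?t312 = "\<lambda>x y z. t z x y"
    and ?t13 = "\<lambda>x y z. t z y x" and ?t231 = "\<lambda>x y z. t y z x"
  note inv = invariant_form_permuted[OF form]
  let ?g = "\<lambda>ri li rj lj. \<phi> (
       psubst (pd1 S) (\<lambda>z. tensor3 ri rj z) (product li lj)
     - psubst (\<lambda>y. - (pd1 S y + pd2 S y)) (\<lambda>z. tensor3 ri z lj) (product rj li)
     + psubst (pd2 S) (\<lambda>z. tensor3 z li lj) (product ri rj))"
  have "\<phi> (ayb S product canonical) = (\<Sum>i=1..n. \<Sum>j=1..n.
      ?g (e i, 0) (0, e' i) (e j, 0) (0, e' j) - ?g (e i, 0) (0, e' i) (0, e' j) (e j, 0)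
      - ?g (0, e' i) (e i, 0) (e j, 0) (0, e' j) + ?g (0, e' i) (e i, 0) (0, e' j) (e j, 0))"
    unfolding ayb_def by (rule functional_double_sum[OF additive_\<phi> \<phi> refl])
  \<comment> \<open>One line for each of the four summands above.  Of the three insertions in a summand, those of the
     product of two elements of \<open>P\<^sup>*\<close> vanish.\<close>
  also have "\<dots> = (\<Sum>i=1..n. \<Sum>j=1..n.
      (dual_term ?t312 j i + mult_term t i j + mult_term ?t23 j i)
      - (- dual_term ?t13 j i - dual_term t i j)
      - (- dual_term ?t231 i j - mult_term ?t312 j i - mult_term ?t12 i j - dual_term ?t23 j i)
      + (mult_term ?t231 i j + mult_term ?t13 j i + dual_term ?t12 i j))"
  proof (intro sum.cong refl, goal_cases)
    case (1 i j)
    note [simp] = form_product_basis[OF form 1] form_product_basis[OF inv(3) 1] form_product_basis[OF inv(5) 1]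
    have G: "?g ri li rj lj = psubst (on_fst D) ?t231 (product li lj) ri rj
       - psubst (on_fst D) ?t312 (product rj li) lj ri + psubst (on_fst D) t (product ri rj) li lj"
      if "ri \<in> Q" "li \<in> Q" "rj \<in> Q" "lj \<in> Q" for ri li rj lj
      using that by (simp only: \<phi>.diff \<phi>.add insert_3_shift_1 insert_2_shift_neg_12 insert_1_shift_2 coeff_product_in)
    note Q = basis_in_Q(1)[of "e i"] basis_in_Q(1)[of "e j"] basis_in_Q(2)[OF 1(1)] basis_in_Q(2)[OF 1(2)]
    show ?case
      unfolding G[OF Q(1,3,2,4)] G[OF Q(1,3,4,2)] G[OF Q(3,1,2,4)] G[OF Q(3,1,4,2)] by simp
  qed
  also have "\<dots> = 0"
  proof -
    have sw: "(\<Sum>i=1..n. \<Sum>j=1..n. X j i) = (\<Sum>i=1..n. \<Sum>j=1..n. X i j)" for X :: "nat \<Rightarrow> nat \<Rightarrow> 'k"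
      by (rule sum.swap)
    show ?thesis
      by (simp only: sum.distrib sum_subtractf sum_negf sw[of "mult_term _"] sw[of "dual_term _"]
          sum_dual_term[OF form] sum_dual_term[OF inv(1)] sum_dual_term[OF inv(2)] sum_dual_term[OF inv(3)]
          sum_dual_term[OF inv(4)] sum_dual_term[OF inv(5)]) simp
  qed
  finally show "\<phi> (ayb S product canonical) = 0" .
qed

end

theorem theorem3p20:
  fixes s :: "'k::field_char_0 poly \<Rightarrow> 'p::ab_group_add \<Rightarrow> 'p"
    and circ zin :: "'p \<Rightarrow> 'p \<Rightarrow> 'p poly"
    and n :: nat
    and e :: "nat \<Rightarrow> 'p"
    and e' :: "nat \<Rightarrow> 'p \<Rightarrow> 'k poly"
  assumes "pre_poisson_conformal_algebra s circ zin"
    and "kd_basis s n e"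
    and "dual_basis s n e e'"
  shows "pcybe_solution
           (sd_scale s (Chom_scale triv_scale))
           (UNIV \<times> cdual s)
           (sd_bracket (Chom_scale triv_scale) (assoc_bracket s circ) (dual_rep circ))
           (sd_product (Chom_scale triv_scale) (assoc_product s zin) (\<lambda>a f. - dual_rep zin a f))
           (\<Sum>i = 1..n. tensor2 (e i, 0) (0, e' i) - tensor2 (0, e' i) (e i, 0))"
proof -
  interpret P: pre_poisson_conformal_algebra s circ zin by fact
  interpret C: based_conformal_product s circ n e e'
    by unfold_locales (fact assms)+
  interpret Z: based_conformal_product s zin n e e'
    by unfold_locales (fact assms)+
  show ?thesis
    unfolding pcybe_solution_def
  proof (intro conjI)
    show "Poly_Mapping.keys (\<Sum>i = 1..n. tensor2 (e i, 0) (0, e' i) - tensor2 (0, e' i) (e i, 0) :: _ \<Rightarrow>\<^sub>0 'k)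
        \<subseteq> (UNIV \<times> cdual s) \<times> (UNIV \<times> cdual s)"
      by (rule keys_sum_tensor2) (simp_all only: C.basis_in_Q)
  qed (rule C.cyb_canonical, rule Z.ayb_canonical)
qed

end
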